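(* Let $n\ge1$ and let $u$ be a $C^2$ (real-valued) function on a domain $D\subset\mathbb{C}^{n+1}\setminus\{0\}$. Then $u$ is plurisubharmonic on $D$ if and only if the $(n+1)\times(n+1)$ matrix $$S(u)=\begin{pmatrix}X_0\bar X_0u+(2r)^{-1}\bar X_0u & X_0\bar X_\beta u\\[4pt] X_\alpha\bar X_0u & X_\alpha\bar X_\beta u+r(\bar X_0u)h_{\alpha\bar\beta}\end{pmatrix}_{1\le\alpha,\beta\le n},$$ or its different version $$S^*(u)=\begin{pmatrix}\bar X_0X_0u+(2r)^{-1}X_0u & \bar X_\beta X_0u\\[4pt] \bar X_0X_\alpha u & \bar X_\beta X_\alpha u+r(X_0u)h_{\alpha\bar\beta}\end{pmatrix}_{1\le\alpha,\beta\le n},$$ is everywhere positive semi-definite on $D$. Moreover, $u$ is strictly plurisubharmonic on $D$ if and only if the matrix is positive definite everywhere on $D$.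
   Context: Complex Hopf-coordinates $(r,\theta,\zeta,\bar\zeta)$: on the set of points of $\mathbb{C}^{n+1}\setminus\{0\}$ with non-vanishing coordinates $z^0,\dots,z^n$, put $r=|z|$, $\zeta^\alpha=z^\alpha/z^0$ ($\alpha=1,\dots,n$), and define the angle $\theta$ by $$z^0=re^{\frac{i}{2}\theta}\frac{\varrho(\zeta,\bar\zeta)}{(1+\sum_\beta|\zeta^\beta|^2)^{1/2}},\qquad z^\alpha=\zeta^\alpha z^0,\qquad \varrho(\zeta,\bar\zeta)=\prod_{\alpha=1}^n\left(\bar\zeta^\alpha|\zeta^\alpha|^{-1}\right)^{1/2}$$ (local branches of the square roots). The associated local basic function is $h(\zeta,\bar\zeta)=\log(1+\sum_\alpha|\zeta^\alpha|^2)-\sum_\alpha\log|\zeta^\alpha|$, with $h_\alpha=\partial h/\partial\zeta^\alpha$, $h_{\bar\alpha}=\partial h/\partial\bar\zeta^\alpha$, $h_{\alpha\bar\beta}=\partial^2h/\partial\zeta^\alpha\partial\bar\zeta^\beta$. The complex vector fields are $$X_0=\tfrac12\left(\partial_r-2ir^{-1}\partial_\theta\right),\quad \bar X_0=\tfrac12\left(\partial_r+2ir^{-1}\partial_\theta\right),\quad X_\alpha=\partial_{\zeta^\alpha}+ih_\alpha\,\partial_\theta,\quad \bar X_\alpha=\partial_{\bar\zeta^\alpha}-ih_{\bar\alpha}\,\partial_\theta .$$ These form a local frame of the complexified tangent bundle, with $X_0,X_\alpha$ of type $(1,0)$. The same formulas are used in other local coordinates of this kind, with a correspondingly changed basic function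 and angle; for instance, near points where some coordinate vanishes, one permutes the coordinates so that $z^0\ne0$ and takes $\varrho\equiv1$, $h=\log(1+\sum_\alpha|\zeta^\alpha|^2)$. The matrices $S(u)$ and $S^*(u)$ at a point of $D$ are computed in such a local coordinate around that point. "Strictly plurisubharmonic" means that the complex Hessian $(\partial^2u/\partial z^A\partial\bar z^B)$ is positive definite at every point. *)

theory Defs
  imports "HOL-Analysis.Analysis"
begin

definition C2_on :: "'a::real_normed_vector set \<Rightarrow> ('a \<Rightarrow> 'b::real_normed_vector) \<Rightarrow> bool" where
  "C2_on D f \<longleftrightarrow>
     (\<exists>(f' :: 'a \<Rightarrow> 'a \<Rightarrow>\<^sub>L 'b) (f'' :: 'a \<Rightarrow> 'a \<Rightarrow>\<^sub>L 'a \<Rightarrow>\<^sub>L 'b).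
        (\<forall>x\<in>D. (f has_derivative blinfun_apply (f' x)) (at x)) \<and>
        (\<forall>x\<in>D. (f' has_derivative blinfun_apply (f'' x)) (at x)) \<and>
        continuous_on D f'')"

text \<open>Wirtinger operators \<open>\<partial>/\<partial>z\<^sup>A = 1/2 (\<partial>/\<partial>x\<^sup>A - \<i> \<partial>/\<partial>y\<^sup>A)\<close> and
  \<open>\<partial>/\<partial>(cnj z\<^sup>A) = 1/2 (\<partial>/\<partial>x\<^sup>A + \<i> \<partial>/\<partial>y\<^sup>A)\<close>.\<close>

definition partial_re :: "'m::finite \<Rightarrow> (complex^'m \<Rightarrow> complex) \<Rightarrow> complex^'m \<Rightarrow> complex" where
  "partial_re A f z = vector_derivative (\<lambda>t::real. f (z + axis A (of_real t))) (at 0)"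

definition partial_im :: "'m::finite \<Rightarrow> (complex^'m \<Rightarrow> complex) \<Rightarrow> complex^'m \<Rightarrow> complex" where
  "partial_im A f z = vector_derivative (\<lambda>t::real. f (z + axis A (\<i> * of_real t))) (at 0)"

definition dz :: "'m::finite \<Rightarrow> (complex^'m \<Rightarrow> complex) \<Rightarrow> complex^'m \<Rightarrow> complex" where
  "dz A f z = (partial_re A f z - \<i> * partial_im A f z) / 2"

definition dzbar :: "'m::finite \<Rightarrow> (complex^'m \<Rightarrow> complex) \<Rightarrow> complex^'m \<Rightarrow> complex" where
  "dzbar A f z = (partial_re A f z + \<i> * partial_im A f z) / 2"

definition hermitian :: "complex^'m^'m \<Rightarrow> bool" where
  "hermitian M \<longleftrightarrow> (\<forall>A B. M $ A $ B = cnj (M $ B $ A))"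

definition pos_semidef :: "complex^'m::finite^'m \<Rightarrow> bool" where
  "pos_semidef M \<longleftrightarrow> hermitian M \<and>
     (\<forall>v :: complex^'m. 0 \<le> Re (\<Sum>A\<in>UNIV. \<Sum>B\<in>UNIV. M $ A $ B * v $ A * cnj (v $ B)))"

definition pos_def :: "complex^'m::finite^'m \<Rightarrow> bool" where
  "pos_def M \<longleftrightarrow> hermitian M \<and>
     (\<forall>v :: complex^'m. v \<noteq> 0 \<longrightarrow> 0 < Re (\<Sum>A\<in>UNIV. \<Sum>B\<in>UNIV. M $ A $ B * v $ A * cnj (v $ B)))"

definition usc_on :: "'a::topological_space set \<Rightarrow> ('a \<Rightarrow> real) \<Rightarrow> bool" where
  "usc_on S f \<longleftrightarrow> (\<forall>a. openin (top_of_set S) {x\<in>S. f x < a})"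

text \<open>Subharmonicity of a real-valued (nowhere \<open>-\<infinity>\<close>) function. An upper semicontinuous function is
  bounded above on circles, so the sub-mean value inequality already forces the circle mean to be
  finite; \<open>integrable_on\<close> is stated explicitly because \<open>integral\<close> is \<open>0\<close> on non-integrable
  functions.\<close>

definition subharmonic_on :: "complex set \<Rightarrow> (complex \<Rightarrow> real) \<Rightarrow> bool" where
  "subharmonic_on S f \<longleftrightarrow> usc_on S f \<and>
     (\<forall>c \<rho>. 0 < \<rho> \<and> cball c \<rho> \<subseteq> S \<longrightarrow>
        (\<lambda>t. f (c + of_real \<rho> * cis t)) integrable_on {0..2*pi} \<and>
        f c \<le> integral {0..2*pi} (\<lambda>t. f (c + of_real \<rho> * cis t)) / (2*pi))"

definition plurisubharmonic_on :: "(complex^'m::finite) set \<Rightarrow> (complex^'m \<Rightarrow> real) \<Rightarrow> bool" where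
  "plurisubharmonic_on D u \<longleftrightarrow> usc_on D u \<and>
     (\<forall>a b. subharmonic_on {t. a + t *s b \<in> D} (\<lambda>t. u (a + t *s b)))"

definition complex_hessian :: "(complex^'m::finite \<Rightarrow> real) \<Rightarrow> complex^'m \<Rightarrow> complex^'m^'m" where
  "complex_hessian u z = (\<chi> A B. dz A (dzbar B (\<lambda>w. of_real (u w))) z)"

definition strictly_plurisubharmonic_on :: "(complex^'m::finite) set \<Rightarrow> (complex^'m \<Rightarrow> real) \<Rightarrow> bool" where
  "strictly_plurisubharmonic_on D u \<longleftrightarrow> (\<forall>z\<in>D. pos_def (complex_hessian u z))"

text \<open>Coordinates on \<open>\<complex>\<^sup>n\<^sup>+\<^sup>1\<close> are indexed by \<open>'n option\<close>, with \<open>n = CARD('n)\<close>: \<open>None\<close> is the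
  index \<open>0\<close> and \<open>Some \<alpha>\<close> are the indices \<open>1, \<dots>, n\<close>.

  Holomorphic functions of several variables are automatically smooth, so asking for \<open>C\<^sup>2\<close>
  below is no restriction.\<close>

definition holomorphic_vec_on :: "(complex^'n::finite \<Rightarrow> complex) \<Rightarrow> (complex^'n) set \<Rightarrow> bool" where
  "holomorphic_vec_on F W \<longleftrightarrow> C2_on W F \<and> (\<forall>\<zeta>\<in>W. \<forall>\<alpha>. dzbar \<alpha> F \<zeta> = 0)"

text \<open>\<open>hopf_gauge W \<rho> h\<close>: on the open set \<open>W\<close> of values of \<open>\<zeta>\<close>, the unimodular factor \<open>\<rho>\<close> and the
  basic function \<open>h\<close> belong to one system of complex Hopf coordinates. Rule \<open>nonvanishing\<close> is
  \<open>\<rho> = \<Prod>\<^sub>\<alpha> (cnj \<zeta>\<^sup>\<alpha> / |\<zeta>\<^sup>\<alpha>|)\<^sup>1\<^sup>/\<^sup>2\<close> with arbitrary continuous branches \<open>b \<alpha>\<close> of the square roots. Rule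
  \<open>change\<close> is the change of basic function \<open>h \<leadsto> h + Re F\<close>, \<open>F\<close> holomorphic, with the corresponding
  change of angle \<open>\<theta> \<leadsto> \<theta> - Im F\<close>.\<close>

inductive hopf_gauge ::
  "(complex^'n::finite) set \<Rightarrow> (complex^'n \<Rightarrow> complex) \<Rightarrow> (complex^'n \<Rightarrow> real) \<Rightarrow> bool"
  for W where
  nonvanishing: "open W \<Longrightarrow>
     (\<And>\<alpha>. continuous_on W (b \<alpha>)) \<Longrightarrow>
     (\<And>\<alpha> \<zeta>. \<zeta> \<in> W \<Longrightarrow> \<zeta> $ \<alpha> \<noteq> 0 \<and> (b \<alpha> \<zeta>)\<^sup>2 = cnj (\<zeta> $ \<alpha>) / of_real (cmod (\<zeta> $ \<alpha>))) \<Longrightarrow>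
     hopf_gauge W (\<lambda>\<zeta>. \<Prod>\<alpha>\<in>UNIV. b \<alpha> \<zeta>)
       (\<lambda>\<zeta>. ln (1 + (\<Sum>\<alpha>\<in>UNIV. (cmod (\<zeta> $ \<alpha>))\<^sup>2)) - (\<Sum>\<alpha>\<in>UNIV. ln (cmod (\<zeta> $ \<alpha>))))"
| affine: "open W \<Longrightarrow>
     hopf_gauge W (\<lambda>\<zeta>. 1) (\<lambda>\<zeta>. ln (1 + (\<Sum>\<alpha>\<in>UNIV. (cmod (\<zeta> $ \<alpha>))\<^sup>2)))"
| change: "hopf_gauge W \<rho> h \<Longrightarrow> holomorphic_vec_on F W \<Longrightarrow>
     hopf_gauge W (\<lambda>\<zeta>. \<rho> \<zeta> * exp (\<i> * of_real (Im (F \<zeta>)) / 2)) (\<lambda>\<zeta>. h \<zeta> + Re (F \<zeta>))"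

text \<open>A system of local Hopf coordinates together with the coordinates \<open>(r, \<theta>, \<zeta>)\<close> of a point.
  \<open>perm A\<close> is the index that the coordinate \<open>z\<^sup>A\<close> receives after permuting the coordinates.\<close>

record 'n hopf =
  perm :: "'n option \<Rightarrow> 'n option"
  phase :: "complex^'n \<Rightarrow> complex"
  basic :: "complex^'n \<Rightarrow> real"
  rad :: real
  ang :: real
  proj :: "complex^'n"

definition hopf_map ::
  "('n option \<Rightarrow> 'n option) \<Rightarrow> (complex^'n::finite \<Rightarrow> complex) \<Rightarrow>
   real \<Rightarrow> real \<Rightarrow> complex^'n \<Rightarrow> complex^('n option)" where
  "hopf_map \<sigma> \<rho> r \<theta> \<zeta> =
     (let z0 = of_real r * exp (\<i> / 2 * of_real \<theta>) * \<rho> \<zeta> /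
                 of_real (sqrt (1 + (\<Sum>\<beta>\<in>UNIV. (cmod (\<zeta> $ \<beta>))\<^sup>2)))
      in \<chi> A. case \<sigma> A of None \<Rightarrow> z0 | Some \<alpha> \<Rightarrow> \<zeta> $ \<alpha> * z0)"

definition hopf_at :: "complex^('n option) \<Rightarrow> 'n::finite hopf \<Rightarrow> bool" where
  "hopf_at p c \<longleftrightarrow> bij (perm c) \<and> 0 < rad c \<and>
     (\<exists>W. proj c \<in> W \<and> hopf_gauge W (phase c) (basic c)) \<and>
     hopf_map (perm c) (phase c) (rad c) (ang c) (proj c) = p"

text \<open>The vector fields act on functions of \<open>(r, \<theta>, \<zeta>)\<close>; \<open>X0b\<close> and \<open>Xb\<close> are the barred fields.\<close>

type_synonym 'n cfun = "real \<Rightarrow> real \<Rightarrow> complex^'n \<Rightarrow> complex"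

definition d_r :: "'n::finite cfun \<Rightarrow> 'n cfun" where
  "d_r f r \<theta> \<zeta> = vector_derivative (\<lambda>s. f s \<theta> \<zeta>) (at r)"

definition d_theta :: "'n::finite cfun \<Rightarrow> 'n cfun" where
  "d_theta f r \<theta> \<zeta> = vector_derivative (\<lambda>s. f r s \<zeta>) (at \<theta>)"

definition X0 :: "'n::finite cfun \<Rightarrow> 'n cfun" where
  "X0 f r \<theta> \<zeta> = (d_r f r \<theta> \<zeta> - 2 * \<i> / of_real r * d_theta f r \<theta> \<zeta>) / 2"

definition X0b :: "'n::finite cfun \<Rightarrow> 'n cfun" where
  "X0b f r \<theta> \<zeta> = (d_r f r \<theta> \<zeta> + 2 * \<i> / of_real r * d_theta f r \<theta> \<zeta>) / 2"

definition X :: "(complex^'n::finite \<Rightarrow> real) \<Rightarrow> 'n \<Rightarrow> 'n cfun \<Rightarrow> 'n cfun" where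
  "X h \<alpha> f r \<theta> \<zeta> =
     dz \<alpha> (f r \<theta>) \<zeta> + \<i> * dz \<alpha> (\<lambda>\<xi>. of_real (h \<xi>)) \<zeta> * d_theta f r \<theta> \<zeta>"

definition Xb :: "(complex^'n::finite \<Rightarrow> real) \<Rightarrow> 'n \<Rightarrow> 'n cfun \<Rightarrow> 'n cfun" where
  "Xb h \<alpha> f r \<theta> \<zeta> =
     dzbar \<alpha> (f r \<theta>) \<zeta> - \<i> * dzbar \<alpha> (\<lambda>\<xi>. of_real (h \<xi>)) \<zeta> * d_theta f r \<theta> \<zeta>"

definition pullback :: "'n::finite hopf \<Rightarrow> (complex^('n option) \<Rightarrow> real) \<Rightarrow> 'n cfun" where
  "pullback c u r \<theta> \<zeta> = of_real (u (hopf_map (perm c) (phase c) r \<theta> \<zeta>))"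

definition S_matrix ::
  "'n::finite hopf \<Rightarrow> (complex^('n option) \<Rightarrow> real) \<Rightarrow> complex^('n option)^('n option)" where
  "S_matrix c u =
     (let U = pullback c u; h = basic c; r = rad c; \<theta> = ang c; \<zeta> = proj c;
          hab = (\<lambda>\<alpha> \<beta>. dz \<alpha> (dzbar \<beta> (\<lambda>\<xi>. of_real (h \<xi>))) \<zeta>)
      in \<chi> A B. case A of
           None \<Rightarrow> (case B of
               None \<Rightarrow> X0 (X0b U) r \<theta> \<zeta> + X0b U r \<theta> \<zeta> / of_real (2 * r)
             | Some \<beta> \<Rightarrow> X0 (Xb h \<beta> U) r \<theta> \<zeta>)
         | Some \<alpha> \<Rightarrow> (case B of
               None \<Rightarrow> X h \<alpha> (X0b U) r \<theta> \<zeta>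
             | Some \<beta> \<Rightarrow> X h \<alpha> (Xb h \<beta> U) r \<theta> \<zeta> + of_real r * X0b U r \<theta> \<zeta> * hab \<alpha> \<beta>))"

definition S_star_matrix ::
  "'n::finite hopf \<Rightarrow> (complex^('n option) \<Rightarrow> real) \<Rightarrow> complex^('n option)^('n option)" where
  "S_star_matrix c u =
     (let U = pullback c u; h = basic c; r = rad c; \<theta> = ang c; \<zeta> = proj c;
          hab = (\<lambda>\<alpha> \<beta>. dz \<alpha> (dzbar \<beta> (\<lambda>\<xi>. of_real (h \<xi>))) \<zeta>)
      in \<chi> A B. case A of
           None \<Rightarrow> (case B of
               None \<Rightarrow> X0b (X0 U) r \<theta> \<zeta> + X0 U r \<theta> \<zeta> / of_real (2 * r)
             | Some \<beta> \<Rightarrow> Xb h \<beta> (X0 U) r \<theta> \<zeta>)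
         | Some \<alpha> \<Rightarrow> (case B of
               None \<Rightarrow> X0b (X h \<alpha> U) r \<theta> \<zeta>
             | Some \<beta> \<Rightarrow> Xb h \<beta> (X h \<alpha> U) r \<theta> \<zeta> + of_real r * X0 U r \<theta> \<zeta> * hab \<alpha> \<beta>))"

text \<open>Such coordinates exist around every point of \<open>\<complex>\<^sup>n\<^sup>+\<^sup>1 - {0}\<close>, and those of rule \<open>nonvanishing\<close>
  around every point with non-vanishing coordinates.\<close>

lemma hopf_map_surj:
  fixes p :: "complex^('n::finite option)"
  assumes "bij \<sigma>" and A: "\<sigma> A = None" "p $ A \<noteq> 0"
    and \<zeta>: "\<zeta> = (\<chi> \<alpha>. p $ (inv \<sigma> (Some \<alpha>)) / p $ A)" and \<rho>: "cmod (\<rho> \<zeta>) = 1"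
  shows "\<exists>r \<theta>. 0 < r \<and> hopf_map \<sigma> \<rho> r \<theta> \<zeta> = p"
proof -
  define s where "s = sqrt (1 + (\<Sum>\<beta>\<in>UNIV. (cmod (\<zeta> $ \<beta>))\<^sup>2))"
  have s: "s > 0"
    unfolding s_def by (simp add: add_pos_nonneg sum_nonneg)
  define r where "r = cmod (p $ A) * s"
  define \<theta> where "\<theta> = 2 * Arg (p $ A / \<rho> \<zeta>)"
  have \<rho>0: "\<rho> \<zeta> \<noteq> 0"
    using \<rho> by auto
  have e: "exp (\<i> / 2 * of_real \<theta>) = p $ A / \<rho> \<zeta> / of_real (cmod (p $ A))"
    using Arg_eq[of "p $ A / \<rho> \<zeta>"] A \<rho>0 \<rho> by (simp add: \<theta>_def norm_divide field_simps)
  have z0: "of_real r * exp (\<i> / 2 * of_real \<theta>) * \<rho> \<zeta> / of_real s = p $ A"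
    unfolding e using A \<rho>0 s by (simp add: r_def)
  have "hopf_map \<sigma> \<rho> r \<theta> \<zeta> $ B = p $ B" for B
  proof (cases "\<sigma> B")
    case None
    then have "B = A"
      using assms(1) A(1) by (metis bij_def injD)
    then show ?thesis
      using None z0 by (simp add: hopf_map_def Let_def s_def)
  next
    case (Some \<alpha>)
    then have "inv \<sigma> (Some \<alpha>) = B"
      using assms(1) by (metis bij_inv_eq_iff)
    then have "\<zeta> $ \<alpha> * p $ A = p $ B"
      using A(2) by (simp add: \<zeta>)
    moreover have "hopf_map \<sigma> \<rho> r \<theta> \<zeta> $ B = \<zeta> $ \<alpha> * p $ A"
      unfolding z0[symmetric] s_def by (simp add: hopf_map_def Let_def Some)
    ultimately show ?thesis
      by simp
  qed
  moreover have "r > 0"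
    using A s by (simp add: r_def)
  ultimately show ?thesis
    by (metis vec_eq_iff)
qed

lemma hopf_at_exists:
  fixes p :: "complex^('n::finite option)"
  assumes "p \<noteq> 0"
  shows "\<exists>c. hopf_at p c"
proof -
  obtain A where A: "p $ A \<noteq> 0"
    using assms by (auto simp: vec_eq_iff)
  define \<sigma> where "\<sigma> = Fun.swap A None id"
  have \<sigma>: "bij \<sigma>" "\<sigma> A = None"
    unfolding \<sigma>_def by auto
  define \<zeta> where "\<zeta> = (\<chi> \<alpha>. p $ (inv \<sigma> (Some \<alpha>)) / p $ A)"
  obtain r \<theta> where "0 < r" "hopf_map \<sigma> (\<lambda>\<zeta>. 1) r \<theta> \<zeta> = p"
    using hopf_map_surj[OF \<sigma> A \<zeta>_def, of "\<lambda>\<zeta>. 1"] by auto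
  moreover have "hopf_gauge UNIV (\<lambda>\<zeta>. 1) (\<lambda>\<zeta>::complex^'n. ln (1 + (\<Sum>\<alpha>\<in>UNIV. (cmod (\<zeta> $ \<alpha>))\<^sup>2)))"
    by (rule hopf_gauge.affine) simp
  ultimately have "hopf_at p \<lparr>perm = \<sigma>, phase = (\<lambda>\<zeta>. 1),
      basic = (\<lambda>\<zeta>. ln (1 + (\<Sum>\<alpha>\<in>UNIV. (cmod (\<zeta> $ \<alpha>))\<^sup>2))), rad = r, ang = \<theta>, proj = \<zeta>\<rparr>"
    using \<sigma> by (auto simp: hopf_at_def)
  then show ?thesis ..
qed

lemma hopf_at_nonvanishing_exists:
  fixes p :: "complex^('n::finite option)"
  assumes p: "\<And>A. p $ A \<noteq> 0"
  shows "\<exists>c. hopf_at p c \<and> perm c = id \<and>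
    basic c = (\<lambda>\<zeta>. ln (1 + (\<Sum>\<alpha>\<in>UNIV. (cmod (\<zeta> $ \<alpha>))\<^sup>2)) - (\<Sum>\<alpha>\<in>UNIV. ln (cmod (\<zeta> $ \<alpha>))))"
proof -
  define \<zeta>0 :: "complex^'n" where "\<zeta>0 = (\<chi> \<alpha>. p $ (inv id (Some \<alpha>)) / p $ None)"
  have \<zeta>0: "\<zeta>0 $ \<alpha> \<noteq> 0" for \<alpha>
    using p by (simp add: \<zeta>0_def)
  define w where "w = (\<lambda>\<alpha> (\<zeta>::complex^'n). cnj (\<zeta> $ \<alpha>) / of_real (cmod (\<zeta> $ \<alpha>)))"
  define W where "W = (\<Inter>\<alpha>. {\<zeta>. 0 < Re (cnj (\<zeta> $ \<alpha>) / cnj (\<zeta>0 $ \<alpha>))})"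
  define b where "b = (\<lambda>\<alpha> \<zeta>. csqrt (w \<alpha> \<zeta>0) * csqrt (w \<alpha> \<zeta> / w \<alpha> \<zeta>0))"
  have "open W"
    unfolding W_def
    by (intro open_INT finite ballI open_Collect_less continuous_intros) (use \<zeta>0 in auto)
  moreover have nz: "\<zeta> $ \<alpha> \<noteq> 0" if "\<zeta> \<in> W" for \<zeta> \<alpha>
    using that by (auto simp: W_def dest!: spec[of _ \<alpha>])
  have w0: "w \<alpha> \<zeta>0 \<noteq> 0" for \<alpha>
    using \<zeta>0 by (simp add: w_def)
  have pos: "w \<alpha> \<zeta> / w \<alpha> \<zeta>0 \<notin> \<real>\<^sub>\<le>\<^sub>0" if "\<zeta> \<in> W" for \<zeta> \<alpha>
  proof -
    have "w \<alpha> \<zeta> / w \<alpha> \<zeta>0 =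
        of_real (cmod (\<zeta>0 $ \<alpha>) / cmod (\<zeta> $ \<alpha>)) * (cnj (\<zeta> $ \<alpha>) / cnj (\<zeta>0 $ \<alpha>))"
      by (simp add: w_def)
    then have "Re (w \<alpha> \<zeta> / w \<alpha> \<zeta>0) =
        cmod (\<zeta>0 $ \<alpha>) / cmod (\<zeta> $ \<alpha>) * Re (cnj (\<zeta> $ \<alpha>) / cnj (\<zeta>0 $ \<alpha>))"
      by (simp only: times_complex.sel Re_complex_of_real Im_complex_of_real mult_zero_left diff_zero)
    moreover have "\<dots> > 0"
      using that nz[OF that, of \<alpha>] \<zeta>0[of \<alpha>] unfolding W_def by (intro mult_pos_pos) auto
    ultimately show ?thesis
      by (auto simp: complex_nonpos_Reals_iff)
  qed
  moreover have "continuous_on W (b \<alpha>)" for \<alpha>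
  proof -
    have "continuous_on (- \<real>\<^sub>\<le>\<^sub>0) csqrt"
      by (rule continuous_at_imp_continuous_on) (auto intro: continuous_at_csqrt)
    moreover have "continuous_on W (\<lambda>\<zeta>. w \<alpha> \<zeta> / w \<alpha> \<zeta>0)"
      unfolding w_def by (intro continuous_intros) (use nz \<zeta>0 in auto)
    moreover have "(\<lambda>\<zeta>. w \<alpha> \<zeta> / w \<alpha> \<zeta>0) ` W \<subseteq> - \<real>\<^sub>\<le>\<^sub>0"
      using pos by auto
    ultimately have "continuous_on W (\<lambda>\<zeta>. csqrt (w \<alpha> \<zeta> / w \<alpha> \<zeta>0))"
      by (rule continuous_on_compose2)
    then show ?thesis
      unfolding b_def by (rule continuous_on_mult_left)
  qed
  moreover have "\<zeta> $ \<alpha> \<noteq> 0 \<and> (b \<alpha> \<zeta>)\<^sup>2 = cnj (\<zeta> $ \<alpha>) / of_real (cmod (\<zeta> $ \<alpha>))" if "\<zeta> \<in> W" for \<alpha> \<zeta>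
    using nz[OF that] w0[of \<alpha>] by (simp add: b_def power_mult_distrib) (simp add: w_def)
  ultimately have g: "hopf_gauge W (\<lambda>\<zeta>. \<Prod>\<alpha>\<in>UNIV. b \<alpha> \<zeta>)
      (\<lambda>\<zeta>. ln (1 + (\<Sum>\<alpha>\<in>UNIV. (cmod (\<zeta> $ \<alpha>))\<^sup>2)) - (\<Sum>\<alpha>\<in>UNIV. ln (cmod (\<zeta> $ \<alpha>))))"
    by (intro hopf_gauge.nonvanishing)
  have "cmod (b \<alpha> \<zeta>0) = 1" for \<alpha>
  proof -
    have "cmod (w \<alpha> \<zeta>0) = 1"
      using \<zeta>0 by (simp add: w_def norm_divide)
    then show ?thesis
      using w0 by (simp add: b_def norm_mult)
  qed
  then have "cmod (\<Prod>\<alpha>\<in>UNIV. b \<alpha> \<zeta>0) = 1"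
    by (simp flip: prod_norm)
  then obtain r \<theta> where "0 < r" "hopf_map id (\<lambda>\<zeta>. \<Prod>\<alpha>\<in>UNIV. b \<alpha> \<zeta>) r \<theta> \<zeta>0 = p"
    using hopf_map_surj[of id None p \<zeta>0 "\<lambda>\<zeta>. \<Prod>\<alpha>\<in>UNIV. b \<alpha> \<zeta>"] p \<zeta>0_def by auto
  moreover have "\<zeta>0 \<in> W"
    using \<zeta>0 by (simp add: W_def)
  ultimately have "hopf_at p \<lparr>perm = id, phase = (\<lambda>\<zeta>. \<Prod>\<alpha>\<in>UNIV. b \<alpha> \<zeta>),
      basic = (\<lambda>\<zeta>. ln (1 + (\<Sum>\<alpha>\<in>UNIV. (cmod (\<zeta> $ \<alpha>))\<^sup>2)) - (\<Sum>\<alpha>\<in>UNIV. ln (cmod (\<zeta> $ \<alpha>)))),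
      rad = r, ang = \<theta>, proj = \<zeta>0\<rparr>"
    using g by (auto simp: hopf_at_def)
  then show ?thesis
    by (intro exI conjI, assumption) simp_all
qed

end

theory Submission
  imports Defs
begin

text \<open>For the standard coordinate functions one checks \<open>X\<^sub>A (cnj z\<^sup>C) = 0\<close> and
  \<open>X\<^sub>A (cnj (X\<^sub>B z\<^sup>C)) = - \<lambda>\<^sub>A\<^sub>B cnj (X\<^sub>0 z\<^sup>C)\<close>, where \<open>\<lambda>\<close> is exactly the first order correction that appears in
  \<open>S(u)\<close>. The chain rule then gives \<open>S(u) = M H M\<^sup>*\<close> with \<open>M\<^sub>A\<^sub>C = X\<^sub>A z\<^sup>C\<close> invertible and \<open>H\<close> the complex
  Hessian of \<open>u\<close>, and complex conjugation gives \<open>S\<^sup>*(u) = S(u)\<close> because \<open>H\<close> is Hermitian. It remains to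
  recall that a \<open>C\<^sup>2\<close> function is plurisubharmonic iff \<open>H\<close> is positive semi-definite; on a complex line
  this follows from \<open>s (s m')' = s\<^sup>2 \<integral> \<Delta>f\<close> for the circle integral \<open>m\<close> of radius \<open>s\<close>.\<close>

section \<open>Second derivatives and subharmonic functions of class C2\<close>

text \<open>The first order correction arises because the coefficients X_B z^C are not holomorphic:
  they contain the factors 1/r and cnj \<zeta>^\<beta> / (1 + |\<zeta>|^2). Differentiating these
  factors leaves multiples of z^C, and z^C = r X_0 z^C, so the error is always proportional to the
  one vector X_0 z^C; summed against the first derivatives of u it becomes a multiple of the radial
  derivative of u. The entry 1/(2r) comes from X_0 (1/r) = -1/(2 r^2), the other one from the
  derivative of \<zeta>^\<beta> / (1 + |\<zeta>|^2), which is the mixed Hessian of h.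

  The obstacle is the freedom in the coordinates: branches of square roots, changes of h by real
  parts of holomorphic functions, a different chart at every point. Each gauge is therefore reduced
  to one holomorphic family \<gamma> that governs the phase and h at the same time, and the
  \<theta>-component of X_\<alpha> cancels it. The fields are defined by real-variable limits, so
  all values are read off from real Frechet derivatives in (r, \<theta>, \<zeta>).\<close>

text \<open>Two applications of the scalar mean value theorem: along \<open>v\<close> to the
  increment of \<open>f\<close> in direction \<open>s *\<^sub>R w\<close>, then along
  \<open>w\<close> to the derivative so obtained. Pairing with \<open>y\<close> makes the functions
  real-valued.\<close>

lemma second_difference_mean_value:
  fixes f :: "'a::real_normed_vector \<Rightarrow> 'b::real_inner"
  assumes f': "\<And>z. z \<in> ball x d \<Longrightarrow> (f has_derivative blinfun_apply (f' z)) (at z)"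
    and f'': "\<And>z. z \<in> ball x d \<Longrightarrow> (f' has_derivative blinfun_apply (f'' z)) (at z)"
    and s: "0 < s" "s * (norm v + norm w) < d"
  shows "\<exists>z\<in>ball x d. (f (x + s *\<^sub>R v + s *\<^sub>R w) - f (x + s *\<^sub>R v) - f (x + s *\<^sub>R w) + f x) \<bullet> y
           = s\<^sup>2 * (f'' z w v \<bullet> y)"
proof -
  have in_ball: "x + a *\<^sub>R v + b *\<^sub>R w \<in> ball x d" if "0 \<le> a" "a \<le> s" "0 \<le> b" "b \<le> s" for a b
  proof -
    have "norm (a *\<^sub>R v + b *\<^sub>R w) \<le> a * norm v + b * norm w"
      using that by (metis abs_of_nonneg norm_scaleR norm_triangle_ineq)
    also have "\<dots> \<le> s * norm v + s * norm w"
      using that by (intro add_mono mult_right_mono) auto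
    finally show ?thesis
      using s by (simp add: dist_norm algebra_simps norm_minus_commute)
  qed
  define g where "g a = (f (x + a *\<^sub>R v + s *\<^sub>R w) - f (x + a *\<^sub>R v)) \<bullet> y" for a
  define g' where "g' a = (f' (x + a *\<^sub>R v + s *\<^sub>R w) v - f' (x + a *\<^sub>R v) v) \<bullet> y" for a
  have der: "((\<lambda>a. f (x + a *\<^sub>R v + b *\<^sub>R w)) has_derivative
      (\<lambda>h. f' (x + a *\<^sub>R v + b *\<^sub>R w) (h *\<^sub>R v))) (at a)"
    if "0 \<le> a" "a \<le> s" "0 \<le> b" "b \<le> s" for a b
    by (rule has_derivative_compose[where f = "\<lambda>a. x + a *\<^sub>R v + b *\<^sub>R w" and g = f,
          OF _ f'[OF in_ball[OF that]]]) (auto intro!: derivative_eq_intros)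
  have "\<exists>a>0. a < s \<and> g s - g 0 = (s - 0) * g' a"
  proof (rule MVT2[OF s(1)])
    fix a assume a: "0 \<le> a" "a \<le> s"
    show "DERIV g a :> g' a"
      unfolding g_def g'_def has_field_derivative_def
      by (rule derivative_eq_intros der[of a s] der[of a 0, simplified] a order_refl less_imp_le s
          refl)+ (auto simp: blinfun.scaleR_right algebra_simps)
  qed
  then obtain a where a: "0 < a" "a < s" "g s - g 0 = s * g' a"
    by auto
  define k where "k b = f' (x + a *\<^sub>R v + b *\<^sub>R w) v \<bullet> y" for b
  have "\<exists>b>0. b < s \<and> k s - k 0 = (s - 0) * (f'' (x + a *\<^sub>R v + b *\<^sub>R w) w v \<bullet> y)"
  proof (rule MVT2[OF s(1)])
    fix b assume b: "0 \<le> b" "b \<le> s"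
    have "((\<lambda>b. f' (x + a *\<^sub>R v + b *\<^sub>R w)) has_derivative
      (\<lambda>h. f'' (x + a *\<^sub>R v + b *\<^sub>R w) (h *\<^sub>R w))) (at b)"
      by (rule has_derivative_compose[where f = "\<lambda>b. x + a *\<^sub>R v + b *\<^sub>R w" and g = f',
            OF _ f''[OF in_ball]]) (use a b in \<open>auto intro!: derivative_eq_intros\<close>)
    then show "DERIV k b :> f'' (x + a *\<^sub>R v + b *\<^sub>R w) w v \<bullet> y"
      unfolding k_def has_field_derivative_def
      by (auto intro!: derivative_eq_intros simp: blinfun.scaleR_right blinfun.scaleR_left algebra_simps)
  qed
  then obtain b where b: "0 < b" "b < s"
    "k s - k 0 = s * (f'' (x + a *\<^sub>R v + b *\<^sub>R w) w v \<bullet> y)"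
    by auto
  have "g s - g 0 = s * (k s - k 0)"
    using a(3) by (simp add: g'_def k_def inner_diff_left)
  then have "g s - g 0 = s\<^sup>2 * (f'' (x + a *\<^sub>R v + b *\<^sub>R w) w v \<bullet> y)"
    using b(3) by (simp add: power2_eq_square)
  moreover have "g s - g 0 =
      (f (x + s *\<^sub>R v + s *\<^sub>R w) - f (x + s *\<^sub>R v) - f (x + s *\<^sub>R w) + f x) \<bullet> y"
    by (simp add: g_def inner_diff_left inner_add_left)
  ultimately show ?thesis
    using in_ball[of a b] a b by (intro bexI[of _ "x + a *\<^sub>R v + b *\<^sub>R w"]) auto
qed

text \<open>The second difference is symmetric in \<open>v\<close> and \<open>w\<close>, so it
  equals a nearby value of the second derivative in either order of the arguments; continuity
  carries the equality to \<open>x\<close>. Values in an inner product space cover both the real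
  function \<open>u\<close> and complex-valued holomorphic functions.\<close>

lemma symmetric_second_derivative:
  fixes f :: "'a::real_normed_vector \<Rightarrow> 'b::real_inner"
  assumes "open D" "x \<in> D"
    and f': "\<And>z. z \<in> D \<Longrightarrow> (f has_derivative blinfun_apply (f' z)) (at z)"
    and f'': "\<And>z. z \<in> D \<Longrightarrow> (f' has_derivative blinfun_apply (f'' z)) (at z)"
    and cont: "continuous_on D f''"
  shows "f'' x v w = f'' x w v"
proof -
  have "f'' x v w \<bullet> y = f'' x w v \<bullet> y" for y
  proof (rule ccontr)
    assume ne: "f'' x v w \<bullet> y \<noteq> f'' x w v \<bullet> y"
    \<comment> \<open>Half the gap: values within \<open>e\<close> of the two different numbers
      cannot coincide.\<close>
    define e where "e = \<bar>f'' x v w \<bullet> y - f'' x w v \<bullet> y\<bar> / 2"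
    have e: "e > 0"
      using ne by (simp add: e_def)
    have cont': "continuous (at x) (\<lambda>z. f'' z a b \<bullet> y)" for a b
      using cont assms(1,2) by (intro continuous_intros) (simp add: continuous_on_eq_continuous_at)
    obtain d1 where d1: "d1 > 0" "\<And>z. dist z x < d1 \<Longrightarrow> \<bar>f'' z v w \<bullet> y - f'' x v w \<bullet> y\<bar> < e"
      using cont'[of v w] e unfolding continuous_at_eps_delta dist_real_def by blast
    obtain d2 where d2: "d2 > 0" "\<And>z. dist z x < d2 \<Longrightarrow> \<bar>f'' z w v \<bullet> y - f'' x w v \<bullet> y\<bar> < e"
      using cont'[of w v] e unfolding continuous_at_eps_delta dist_real_def by blast
    obtain d3 where d3: "d3 > 0" "ball x d3 \<subseteq> D"
      using assms(1,2) open_contains_ball by blast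
    define d where "d = min d1 (min d2 d3)"
    have d: "d > 0" "ball x d \<subseteq> D"
      using d1 d2 d3 by (auto simp: d_def)
    \<comment> \<open>The summand 1 keeps the denominator positive when \<open>v\<close> and
      \<open>w\<close> both vanish.\<close>
    define s where "s = d / (2 * (norm v + norm w + 1))"
    have pos: "norm v + norm w + 1 > 0"
      by (simp add: add_nonneg_pos)
    have s: "s > 0"
      using d pos by (simp add: s_def)
    have "norm v + norm w < 2 * (norm v + norm w + 1)"
      using pos by argo
    then have "s * (norm v + norm w) < s * (2 * (norm v + norm w + 1))"
      using s by (rule mult_strict_left_mono)
    also have "\<dots> = d"
      using pos unfolding s_def by (simp add: field_simps)
    finally have sd: "s * (norm v + norm w) < d" .
    obtain z1 where z1: "z1 \<in> ball x d"
      "(f (x + s *\<^sub>R v + s *\<^sub>R w) - f (x + s *\<^sub>R v) - f (x + s *\<^sub>R w) + f x) \<bullet> y = s\<^sup>2 * (f'' z1 w v \<bullet> y)"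
      using second_difference_mean_value[of x d f f' f'' s v w y] f' f'' d s sd by blast
    obtain z2 where z2: "z2 \<in> ball x d"
      "(f (x + s *\<^sub>R w + s *\<^sub>R v) - f (x + s *\<^sub>R w) - f (x + s *\<^sub>R v) + f x) \<bullet> y = s\<^sup>2 * (f'' z2 v w \<bullet> y)"
      using second_difference_mean_value[of x d f f' f'' s w v y] f' f'' d s sd
      unfolding add.commute[of "norm w"] by blast
    have "x + s *\<^sub>R w + s *\<^sub>R v = x + s *\<^sub>R v + s *\<^sub>R w"
      by simp
    then have "s\<^sup>2 * (f'' z1 w v \<bullet> y) = s\<^sup>2 * (f'' z2 v w \<bullet> y)"
      using z1(2) z2(2) by (simp add: algebra_simps inner_diff_left inner_add_left)
    then have "f'' z1 w v \<bullet> y = f'' z2 v w \<bullet> y"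
      using s by simp
    moreover have "\<bar>f'' z2 v w \<bullet> y - f'' x v w \<bullet> y\<bar> < e" "\<bar>f'' z1 w v \<bullet> y - f'' x w v \<bullet> y\<bar> < e"
      using z1(1) z2(1) by (auto intro!: d1(2) d2(2) simp: d_def dist_commute)
    ultimately show False
      unfolding e_def by (auto simp: abs_if split: if_splits)
  qed
  then show ?thesis
    by (rule iffD1[OF vector_eq_rdot, OF allI])
qed

section \<open>Circle means of a function of class C2 in the plane\<close>

text \<open>\<open>p\<close> and \<open>q\<close> are the partial derivatives of \<open>f\<close> in
  x and y, and \<open>px + qy\<close> is its Laplacian. Keeping the derivatives as parameters lets
  the restriction of \<open>u\<close> to a complex line be inserted with its derivatives already in
  closed form.\<close>

locale planar_C2 =
  fixes f p q px py qx qy :: "complex \<Rightarrow> real" and S :: "complex set"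
  assumes df: "\<And>z. z \<in> S \<Longrightarrow> (f has_derivative (\<lambda>h. Re h * p z + Im h * q z)) (at z)"
    and dp: "\<And>z. z \<in> S \<Longrightarrow> (p has_derivative (\<lambda>h. Re h * px z + Im h * py z)) (at z)"
    and dq: "\<And>z. z \<in> S \<Longrightarrow> (q has_derivative (\<lambda>h. Re h * qx z + Im h * qy z)) (at z)"
    and cont: "continuous_on S px" "continuous_on S py" "continuous_on S qx" "continuous_on S qy"
begin

lemma cont_f: "continuous_on S f" and cont_p: "continuous_on S p" and cont_q: "continuous_on S q"
  by (rule has_derivative_continuous_on[OF has_derivative_at_withinI], erule df dp dq)+

definition circle_integral :: "complex \<Rightarrow> real \<Rightarrow> real" where
  "circle_integral c s = integral {0..2*pi} (\<lambda>t. f (c + of_real s * cis t))"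

text \<open>With F(s,t) = f(c + s e^(it)), the polar form of the Laplacian reads s^2 \<Delta>f = s
  (s F_s)_s + F_tt. The term F_tt integrates to 0 over a period, and differentiation under the
  integral does the rest.\<close>

lemma circle_integral_derivatives:
  assumes "cball c R \<subseteq> S" "0 < R"
  obtains k where "\<And>s. s \<in> {0<..<R} \<Longrightarrow> (circle_integral c has_real_derivative k s) (at s)"
    and "continuous_on {0..R} (circle_integral c)" and "continuous_on {0..R} k"
    and "\<And>s. s \<in> {0<..<R} \<Longrightarrow> ((\<lambda>s. s * k s) has_real_derivative
        s * integral {0..2*pi} (\<lambda>t. px (c + of_real s * cis t) + qy (c + of_real s * cis t))) (at s)"
proof -
  have in_S: "c + of_real s * cis t \<in> S" if "s \<in> {0..R}" for s t
    using that assms(1) by (auto simp: norm_mult dist_norm subset_iff)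
  have cont_comp: "continuous_on T (\<lambda>x. g (c + of_real (a x) * cis (b x)))"
    if "continuous_on S g" "continuous_on T a" "continuous_on T b" "\<And>x. x \<in> T \<Longrightarrow> a x \<in> {0..R}"
    for g :: "complex \<Rightarrow> real" and T :: "'x::topological_space set" and a b
    by (rule continuous_on_compose2[OF that(1)])
       (use that in_S in \<open>auto intro!: continuous_intros continuous_on_cis\<close>)
  define Fs where "Fs s t = cos t * p (c + of_real s * cis t) + sin t * q (c + of_real s * cis t)" for s t
  define Fss where "Fss s t = cos t * (cos t * px (c + of_real s * cis t) + sin t * py (c + of_real s * cis t))
      + sin t * (cos t * qx (c + of_real s * cis t) + sin t * qy (c + of_real s * cis t))" for s t
  define Ft where "Ft s t = s * (cos t * q (c + of_real s * cis t) - sin t * p (c + of_real s * cis t))" for s t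
  define Ftt where "Ftt s t = s * (- sin t * q (c + of_real s * cis t) - cos t * p (c + of_real s * cis t))
      + s\<^sup>2 * (cos t * (- sin t * qx (c + of_real s * cis t) + cos t * qy (c + of_real s * cis t))
             - sin t * (- sin t * px (c + of_real s * cis t) + cos t * py (c + of_real s * cis t)))" for s t
  have radial: "((\<lambda>s. g (c + of_real s * cis t)) has_real_derivative
      (cos t * gx (c + of_real s * cis t) + sin t * gy (c + of_real s * cis t))) (at s within T)"
    if "\<And>z. z \<in> S \<Longrightarrow> (g has_derivative (\<lambda>h. Re h * gx z + Im h * gy z)) (at z)" "s \<in> {0..R}"
    for g gx gy s t T
    unfolding has_field_derivative_def
    by (rule has_derivative_eq_rhs,
        rule has_derivative_compose[where f = "\<lambda>s. c + of_real s * cis t" and g = g,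
          OF _ that(1)[OF in_S[OF that(2)]]])
       (auto intro!: derivative_eq_intros simp: fun_eq_iff algebra_simps)
  have angular: "((\<lambda>t. g (c + of_real s * cis t)) has_real_derivative
      (s * (- sin t * gx (c + of_real s * cis t) + cos t * gy (c + of_real s * cis t)))) (at t within T)"
    if "\<And>z. z \<in> S \<Longrightarrow> (g has_derivative (\<lambda>h. Re h * gx z + Im h * gy z)) (at z)" "s \<in> {0..R}"
    for g gx gy s t T
  proof -
    have "(cis has_derivative (\<lambda>h. h *\<^sub>R (\<i> * cis t))) (at t within T)"
      using has_derivative_cis[OF has_derivative_ident] by simp
    then show ?thesis
      unfolding has_field_derivative_def
      by (intro has_derivative_eq_rhs[OF has_derivative_compose[where
            f = "\<lambda>t. c + of_real s * cis t" and g = g, OF _ that(1)[OF in_S[OF that(2)]]]])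
         (auto intro!: derivative_eq_intros simp: fun_eq_iff algebra_simps)
  qed
  have d1: "((\<lambda>s. f (c + of_real s * cis t)) has_real_derivative Fs s t) (at s within T)"
    if "s \<in> {0..R}" for s t T
    unfolding Fs_def by (rule radial[OF df that])
  have d2: "((\<lambda>s. Fs s t) has_real_derivative Fss s t) (at s within T)" if "s \<in> {0..R}" for s t T
    unfolding Fs_def Fss_def
    by (auto intro!: derivative_eq_intros radial[OF dp that] radial[OF dq that])
  have d3: "((\<lambda>t. Ft s t) has_real_derivative Ftt s t) (at t within T)" if "s \<in> {0..R}" for s t T
    unfolding Ft_def Ftt_def
    by (auto intro!: derivative_eq_intros angular[OF dp that] angular[OF dq that])
       (simp add: algebra_simps power2_eq_square)
  note ci = continuous_intros cont_comp[OF cont_f] cont_comp[OF cont_p] cont_comp[OF cont_q]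
    cont_comp[OF cont(1)] cont_comp[OF cont(2)] cont_comp[OF cont(3)] cont_comp[OF cont(4)]
  have c1: "continuous_on ({0..R} \<times> {0..2*pi}) (\<lambda>(s,t). Fs s t)"
    unfolding Fs_def split_beta by (intro ci) auto
  have c2: "continuous_on ({0..R} \<times> {0..2*pi}) (\<lambda>(s,t). Fss s t)"
    unfolding Fss_def split_beta by (intro ci) auto
  have c0: "(\<lambda>t. f (c + of_real s * cis t)) integrable_on {0..2*pi}" if "s \<in> {0..R}" for s
    by (intro integrable_continuous_real ci) (use that in auto)
  have cs: "Fs s integrable_on {0..2*pi}" if "s \<in> {0..R}" for s
    unfolding Fs_def by (intro integrable_continuous_real ci) (use that in auto)
  have css: "Fss s integrable_on {0..2*pi}" if "s \<in> {0..R}" for s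
    unfolding Fss_def by (intro integrable_continuous_real ci) (use that in auto)
  define k where "k s = integral {0..2*pi} (Fs s)" for s
  \<comment> \<open>The derivatives are taken within the closed interval, which yields continuity of
    the circle integral and of \<open>k\<close> down to s = 0, where polar coordinates degenerate;
    in the interior they are two-sided.\<close>
  have m': "(circle_integral c has_real_derivative k s) (at s within {0..R})" if "s \<in> {0..R}" for s
    unfolding circle_integral_def k_def
    using leibniz_rule_field_derivative[of "{0..R}" 0 "2*pi" "\<lambda>s t. f (c + of_real s * cis t)" Fs s]
      d1 c0 c1 that by auto
  have k': "(k has_real_derivative integral {0..2*pi} (Fss s)) (at s within {0..R})" if "s \<in> {0..R}" for s
    unfolding k_def
    using leibniz_rule_field_derivative[of "{0..R}" 0 "2*pi" Fs Fss s]
      d2 cs c2 that by auto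
  have at: "at s within {0..R} = at s" if "s \<in> {0<..<R}" for s
    using that at_within_Icc_at[of 0 s R] by simp
  have main: "((\<lambda>s. s * k s) has_real_derivative
        s * integral {0..2*pi} (\<lambda>t. px (c + of_real s * cis t) + qy (c + of_real s * cis t))) (at s)"
    (is "(_ has_real_derivative s * ?I) _") if s: "s \<in> {0<..<R}" for s
  proof -
    have s': "s \<in> {0..R}" using s by auto
    \<comment> \<open>\<open>Ft s\<close> has period 2 pi, so its boundary values cancel.\<close>
    have "(Ftt s has_integral (Ft s (2*pi) - Ft s 0)) {0..2*pi}"
      by (rule fundamental_theorem_of_calculus)
         (auto intro!: d3 s' simp: has_real_derivative_iff_has_vector_derivative[symmetric])
    then have itt: "(Ftt s has_integral 0) {0..2*pi}"
      by (simp add: Ft_def)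
    have polar: "px (c + of_real s * cis t) + qy (c + of_real s * cis t)
        = (Fs s t + s * Fss s t) / s + Ftt s t / s\<^sup>2" for t
    proof -
      \<comment> \<open>\<open>C\<close> and \<open>E\<close> stand for cosine and sine: the first
        order terms and the mixed second derivatives cancel, and the remaining terms carry the
        factor \<open>E\<^sup>2 + C\<^sup>2\<close>.\<close>
      have alg: "s * s * (a + d) = s * ((C * u + E * v) + s * (C * (C * a + E * b) + E * (C * e + E * d)))
          + (s * (- E * v - C * u) + s\<^sup>2 * (C * (- E * e + C * d) - E * (- E * a + C * b)))"
        if "E\<^sup>2 + C\<^sup>2 = 1" for a b d e u v C E :: real
      proof -
        have "s * s * (a + d) = s * s * (a + d) * (E\<^sup>2 + C\<^sup>2)"
          using that by simp
        then show ?thesis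
          by (simp add: algebra_simps power2_eq_square)
      qed
      have "s * s * (px (c + of_real s * cis t) + qy (c + of_real s * cis t))
        = s * (Fs s t + s * Fss s t) + Ftt s t"
        unfolding Fs_def Fss_def Ftt_def by (rule alg) simp
      then show ?thesis
        using s by (simp add: field_simps power2_eq_square)
    qed
    have "((\<lambda>t. (Fs s t + s * Fss s t) / s + Ftt s t / s\<^sup>2) has_integral
        (k s + s * integral {0..2*pi} (Fss s)) / s + 0 / s\<^sup>2) {0..2*pi}"
      unfolding k_def
      by (intro has_integral_add has_integral_divide has_integral_mult_right itt
          integrable_integral cs css s')
    then have "?I = (k s + s * integral {0..2*pi} (Fss s)) / s"
      unfolding polar by (simp add: integral_unique)
    moreover have "((\<lambda>s. s * k s) has_real_derivative (k s + s * integral {0..2*pi} (Fss s))) (at s)"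
      using k'[OF s'] unfolding at[OF s] by (auto intro!: derivative_eq_intros)
    ultimately show ?thesis
      using s by simp
  qed
  show thesis
  proof (rule that[of k])
    show "continuous_on {0..R} (circle_integral c)" "continuous_on {0..R} k"
      by (rule DERIV_continuous_on, erule m' k')+
    show "(circle_integral c has_real_derivative k s) (at s)" if "s \<in> {0<..<R}" for s
      using m'[of s] that at[OF that] by auto
  qed (rule main)
qed

text \<open>The function s k(s) vanishes at s = 0 and has nonnegative derivative, so k is
  nonnegative for s > 0. Hence the circle integral grows from its value 2 pi f(c) at radius
  0.\<close>

lemma circle_mean_ge:
  assumes "cball c R \<subseteq> S" "0 < R" and pos: "\<And>z. z \<in> cball c R \<Longrightarrow> 0 \<le> px z + qy z"
  shows "2 * pi * f c \<le> integral {0..2*pi} (\<lambda>t. f (c + of_real R * cis t))"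
proof -
  obtain k where k: "\<And>s. s \<in> {0<..<R} \<Longrightarrow> (circle_integral c has_real_derivative k s) (at s)"
      "continuous_on {0..R} (circle_integral c)" "continuous_on {0..R} k"
      "\<And>s. s \<in> {0<..<R} \<Longrightarrow> ((\<lambda>s. s * k s) has_real_derivative
        s * integral {0..2*pi} (\<lambda>t. px (c + of_real s * cis t) + qy (c + of_real s * cis t))) (at s)"
    using circle_integral_derivatives[OF assms(1,2)] by blast
  have "0 \<le> k s" if s: "s \<in> {0<..<R}" for s
  proof -
    have "0 * k 0 \<le> s * k s"
    proof (rule DERIV_nonneg_imp_increasing_open[of 0 s "\<lambda>s. s * k s"])
      show "continuous_on {0..s} (\<lambda>s. s * k s)"
        using s by (intro continuous_intros continuous_on_subset[OF k(3)]) auto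
      fix x assume x: "0 < x" "x < s"
      \<comment> \<open>Integrability may be left undecided: a non-integrable function has integral
        0, which is also nonnegative.\<close>
      have "0 \<le> integral {0..2*pi} (\<lambda>t. px (c + of_real x * cis t) + qy (c + of_real x * cis t))"
        by (cases "(\<lambda>t. px (c + of_real x * cis t) + qy (c + of_real x * cis t)) integrable_on {0..2*pi}")
           (use x s in \<open>auto intro!: integral_nonneg pos simp: norm_mult dist_norm not_integrable_integral\<close>)
      then show "\<exists>y. ((\<lambda>s. s * k s) has_real_derivative y) (at x) \<and> 0 \<le> y"
        using k(4)[of x] x s by fastforce
    qed (use s in auto)
    then show ?thesis
      using s by (simp add: zero_le_mult_iff)
  qed
  then have "circle_integral c 0 \<le> circle_integral c R"
    using k(1,2) assms(2)
    by (intro DERIV_nonneg_imp_increasing_open[of 0 R "circle_integral c"]) fastforce+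
  then show ?thesis
    by (simp add: circle_integral_def)
qed

text \<open>The same monotonicity argument with strict signs; it supplies the contradiction when the
  Laplacian is negative somewhere.\<close>

lemma circle_mean_less:
  assumes "cball c R \<subseteq> S" "0 < R" and neg: "\<And>z. z \<in> cball c R \<Longrightarrow> px z + qy z < 0"
  shows "integral {0..2*pi} (\<lambda>t. f (c + of_real R * cis t)) < 2 * pi * f c"
proof -
  obtain k where k: "\<And>s. s \<in> {0<..<R} \<Longrightarrow> (circle_integral c has_real_derivative k s) (at s)"
      "continuous_on {0..R} (circle_integral c)" "continuous_on {0..R} k"
      "\<And>s. s \<in> {0<..<R} \<Longrightarrow> ((\<lambda>s. s * k s) has_real_derivative
        s * integral {0..2*pi} (\<lambda>t. px (c + of_real s * cis t) + qy (c + of_real s * cis t))) (at s)"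
    using circle_integral_derivatives[OF assms(1,2)] by blast
  have "k s < 0" if s: "s \<in> {0<..<R}" for s
  proof -
    have "s * k s < 0 * k 0"
    proof (rule DERIV_neg_imp_decreasing_open[of 0 s "\<lambda>s. s * k s"])
      show "continuous_on {0..s} (\<lambda>s. s * k s)"
        using s by (intro continuous_intros continuous_on_subset[OF k(3)]) auto
      fix x assume x: "0 < x" "x < s"
      define g where "g t = px (c + of_real x * cis t) + qy (c + of_real x * cis t)" for t
      have inS: "c + of_real x * cis t \<in> cball c R" for t
        using x s by (auto simp: norm_mult dist_norm)
      \<comment> \<open>Strictness rules out the default value 0 of a non-integrable function, so
        continuity of the integrand is established here.\<close>
      have cg: "continuous_on {0..2*pi} g"
        unfolding g_def
        by (intro continuous_intros continuous_on_compose2[OF cont(1)] continuous_on_compose2[OF cont(4)]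
            continuous_on_cis) (use inS assms(1) in auto)
      have "integral {0..2*pi} g < integral {0..2*pi} (\<lambda>t. 0)"
      proof (rule integral_less_real[OF cg])
        show "g t < 0" if "t \<in> {0<..<2*pi}" for t
          using neg[OF inS] by (simp add: g_def)
      qed (auto simp: not_le)
      then have "x * integral {0..2*pi} g < 0"
        using x by (simp add: mult_pos_neg)
      then show "\<exists>y. ((\<lambda>s. s * k s) has_real_derivative y) (at x) \<and> y < 0"
        using k(4)[of x] x s unfolding g_def by auto
    qed (use s in auto)
    then show ?thesis
      using s by (simp add: mult_less_0_iff)
  qed
  then have "circle_integral c R < circle_integral c 0"
    using k(1,2) assms(2)
    by (intro DERIV_neg_imp_decreasing_open[of 0 R "circle_integral c"]) fastforce+
  then show ?thesis
    by (simp add: circle_integral_def)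
qed

lemma subharmonic_on_iff_laplacian_nonneg:
  assumes S: "open S"
  shows "subharmonic_on S f \<longleftrightarrow> (\<forall>z\<in>S. 0 \<le> px z + qy z)"
proof
  assume sub: "subharmonic_on S f"
  show "\<forall>z\<in>S. 0 \<le> px z + qy z"
  proof (rule ccontr)
    assume "\<not> ?thesis"
    then obtain z where z: "z \<in> S" "px z + qy z < 0"
      by force
    \<comment> \<open>Continuity spreads a negative Laplacian from one point to a closed disc, where
      the strict mean inequality contradicts subharmonicity.\<close>
    have "open {w \<in> S. px w + qy w < 0}"
      using continuous_open_preimage[OF _ S, of "\<lambda>w. px w + qy w" "{..<0}"] cont
      by (auto simp: vimage_def Int_def intro!: continuous_intros)
    then obtain R where R: "R > 0" "cball z R \<subseteq> {w \<in> S. px w + qy w < 0}"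
      using z open_contains_cball by (metis (no_types, lifting) mem_Collect_eq)
    then have "integral {0..2*pi} (\<lambda>t. f (z + of_real R * cis t)) < 2 * pi * f z"
      by (intro circle_mean_less) auto
    moreover have "f z \<le> integral {0..2*pi} (\<lambda>t. f (z + of_real R * cis t)) / (2*pi)"
      using sub R unfolding subharmonic_on_def by blast
    ultimately show False
      by (simp add: field_simps)
  qed
next
  assume pos: "\<forall>z\<in>S. 0 \<le> px z + qy z"
  have "(\<lambda>t. f (c + of_real R * cis t)) integrable_on {0..2*pi} \<and>
      f c \<le> integral {0..2*pi} (\<lambda>t. f (c + of_real R * cis t)) / (2*pi)"
    if R: "0 < R" "cball c R \<subseteq> S" for c R
  proof
    have "c + of_real R * cis t \<in> S" for t
      using R by (auto simp: norm_mult dist_norm subset_iff)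
    then show "(\<lambda>t. f (c + of_real R * cis t)) integrable_on {0..2*pi}"
      by (intro integrable_continuous_real continuous_on_compose2[OF cont_f] continuous_intros
          continuous_on_cis) auto
    show "f c \<le> integral {0..2*pi} (\<lambda>t. f (c + of_real R * cis t)) / (2*pi)"
      using circle_mean_ge[of c R] R pos by (simp add: field_simps subset_iff)
  qed
  moreover have "usc_on S f"
    unfolding usc_on_def
    using continuous_openin_preimage_gen[OF cont_f open_lessThan]
    by (auto simp: vimage_def Int_def)
  ultimately show "subharmonic_on S f"
    by (simp add: subharmonic_on_def)
qed

end

section \<open>The Levi form\<close>

lemma C2_onE:
  assumes "C2_on D f"
  obtains f' f'' where "\<And>x. x \<in> D \<Longrightarrow> (f has_derivative blinfun_apply (f' x)) (at x)"
    and "\<And>x. x \<in> D \<Longrightarrow> (f' has_derivative blinfun_apply (f'' x)) (at x)"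
    and "continuous_on D f''"
  using assms unfolding C2_on_def by (elim exE conjE) (rule that; blast)

lemma axis_complex_scaleR:
  "axis A (of_real t) = t *\<^sub>R axis A (1::complex)" "axis A (\<i> * of_real t) = t *\<^sub>R axis A \<i>"
  by (auto simp: axis_def vec_eq_iff complex_eq_iff)

lemma partial_eqI:
  assumes "(f has_derivative f') (at z)"
  shows partial_re_eqI: "partial_re A f z = f' (axis A 1)"
    and partial_im_eqI: "partial_im A f z = f' (axis A \<i>)"
proof -
  have "((\<lambda>t. f (z + t *\<^sub>R e)) has_vector_derivative f' e) (at 0)" for e
  proof -
    have "((\<lambda>t. f (z + t *\<^sub>R e)) has_derivative (\<lambda>t. f' (t *\<^sub>R e))) (at 0)"
      by (rule has_derivative_compose[where f = "\<lambda>t. z + t *\<^sub>R e" and g = f])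
         (use assms in \<open>auto intro!: derivative_eq_intros\<close>)
    then show ?thesis
      unfolding has_vector_derivative_def
      using assms by (simp add: linear_cmul[OF has_derivative_linear[OF assms]])
  qed
  then show "partial_re A f z = f' (axis A 1)" "partial_im A f z = f' (axis A \<i>)"
    unfolding partial_re_def partial_im_def axis_complex_scaleR
    by (auto intro: vector_derivative_at)
qed

text \<open>The Wirtinger operators are defined by limits along coordinate lines; through these
  rules a Frechet derivative, evaluated at \<open>axis A 1\<close> and \<open>axis A \<i>\<close>,
  determines them.\<close>

lemma dz_eqI: "(f has_derivative f') (at z) \<Longrightarrow> dz A f z = (f' (axis A 1) - \<i> * f' (axis A \<i>)) / 2"
  and dzbar_eqI: "(f has_derivative f') (at z) \<Longrightarrow> dzbar A f z = (f' (axis A 1) + \<i> * f' (axis A \<i>)) / 2"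
  by (simp_all add: dz_def dzbar_def partial_eqI)

lemma linear_axis_expansion:
  fixes L :: "complex^'m::finite \<Rightarrow> complex"
  assumes "linear L"
  shows "L v = (\<Sum>A\<in>UNIV. of_real (Re (v $ A)) * L (axis A 1) + of_real (Im (v $ A)) * L (axis A \<i>))"
proof -
  have "v = (\<Sum>A\<in>UNIV. Re (v $ A) *\<^sub>R axis A 1 + Im (v $ A) *\<^sub>R axis A \<i>)"
    by (auto simp: vec_eq_iff axis_def complex_eq_iff if_distrib[of "\<lambda>x. _ *\<^sub>R x"]
        if_distrib[of Re] if_distrib[of Im] sum.distrib cong: if_cong)
  then have "L v = L (\<Sum>A\<in>UNIV. Re (v $ A) *\<^sub>R axis A 1 + Im (v $ A) *\<^sub>R axis A \<i>)"
    by simp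
  then show ?thesis
    using assms by (simp add: linear_sum linear_add linear_cmul scaleR_conv_of_real[where 'a = complex])
qed

text \<open>A real-linear map splits into its complex-linear part v \<mapsto> (L v - \<i> L(\<i> v))
  / 2 and its conjugate-linear part v \<mapsto> (L v + \<i> L(\<i> v)) / 2. The sums on the left are
  these parts in coordinates, and their coefficients are Wirtinger derivatives when L is a
  differential.\<close>

lemma complex_linear_part:
  fixes L :: "complex^'m::finite \<Rightarrow> complex"
  assumes "linear L"
  shows "(\<Sum>A\<in>UNIV. (L (axis A 1) - \<i> * L (axis A \<i>)) / 2 * v $ A) = (L v - \<i> * L (\<i> *s v)) / 2"
    and "(\<Sum>A\<in>UNIV. (L (axis A 1) + \<i> * L (axis A \<i>)) / 2 * cnj (v $ A)) = (L v + \<i> * L (\<i> *s v)) / 2"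
proof -
  have 1: "(a - \<i> * b) / 2 * w = ((of_real (Re w) * a + of_real (Im w) * b)
      - \<i> * (of_real (Re (\<i> * w)) * a + of_real (Im (\<i> * w)) * b)) / 2" for a b w
    by (subst complex_eq[of w]) (simp add: algebra_simps)
  have 2: "(a + \<i> * b) / 2 * cnj w = ((of_real (Re w) * a + of_real (Im w) * b)
      + \<i> * (of_real (Re (\<i> * w)) * a + of_real (Im (\<i> * w)) * b)) / 2" for a b w
    by (subst complex_eq[of w]) (simp add: algebra_simps)
  note exp = linear_axis_expansion[OF assms, of v] linear_axis_expansion[OF assms, of "\<i> *s v"]
  show "(\<Sum>A\<in>UNIV. (L (axis A 1) - \<i> * L (axis A \<i>)) / 2 * v $ A) = (L v - \<i> * L (\<i> *s v)) / 2"
    unfolding 1 exp sum_distrib_left sum_subtractf[symmetric] sum_divide_distrib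
    by (simp only: vector_smult_component)
  show "(\<Sum>A\<in>UNIV. (L (axis A 1) + \<i> * L (axis A \<i>)) / 2 * cnj (v $ A)) = (L v + \<i> * L (\<i> *s v)) / 2"
    unfolding 2 exp sum_distrib_left sum.distrib[symmetric] sum_divide_distrib
    by (simp only: vector_smult_component)
qed

lemma derivative_wirtinger:
  assumes "(f has_derivative f') (at z)"
  shows "f' v = (\<Sum>A\<in>UNIV. dz A f z * v $ A + dzbar A f z * cnj (v $ A))"
  unfolding dz_eqI[OF assms] dzbar_eqI[OF assms] sum.distrib
    complex_linear_part[OF has_derivative_linear[OF assms]]
  by (simp add: field_simps)

lemma has_derivative_vector_scalar_left:
  "((\<lambda>t::complex. a + t *s b) has_derivative (\<lambda>h. Re h *\<^sub>R b + Im h *\<^sub>R (\<i> *s b))) (at t)"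
  for b :: "complex^'m::finite"
proof -
  have *: "a + t *s b = a + (Re t *\<^sub>R b + Im t *\<^sub>R (\<i> *s b))" for t
    by (simp add: vec_eq_iff complex_eq_iff)
  show ?thesis
    unfolding * by (auto intro!: derivative_eq_intros)
qed

lemma open_complex_line:
  fixes D :: "(complex^'m::finite) set"
  assumes "open D"
  shows "open {t. a + t *s b \<in> D}"
proof -
  have "continuous_on UNIV (\<lambda>t. a + t *s b)"
    by (rule has_derivative_continuous_on[OF has_derivative_at_withinI[OF has_derivative_vector_scalar_left]])
  then have "open ((\<lambda>t. a + t *s b) -` D)"
    using assms by (simp add: continuous_on_open_vimage)
  then show ?thesis
    by (simp add: vimage_def)
qed

section \<open>Plurisubharmonicity and the complex Hessian\<close>

context
  fixes D :: "(complex^'m::finite) set" and u :: "complex^'m \<Rightarrow> real" and u' u''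
  assumes D: "open D"
    and u': "\<And>x. x \<in> D \<Longrightarrow> (u has_derivative blinfun_apply (u' x)) (at x)"
    and u'': "\<And>x. x \<in> D \<Longrightarrow> (u' has_derivative blinfun_apply (u'' x)) (at x)"
    and cont: "continuous_on D u''"
begin

text \<open>On the complex line a + t b the real directions of t correspond to \<open>b\<close> and
  \<open>\<i> *s b\<close>, so the Laplacian in t is the sum of the two pure second derivatives of
  \<open>u\<close> in these directions.\<close>

lemma plurisubharmonic_on_iff_levi:
  "plurisubharmonic_on D u \<longleftrightarrow> (\<forall>z\<in>D. \<forall>b. 0 \<le> u'' z b b + u'' z (\<i> *s b) (\<i> *s b))"
proof -
  have sub: "subharmonic_on {t. a + t *s b \<in> D} (\<lambda>t. u (a + t *s b)) \<longleftrightarrow>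
      (\<forall>t\<in>{t. a + t *s b \<in> D}. 0 \<le> u'' (a + t *s b) b b + u'' (a + t *s b) (\<i> *s b) (\<i> *s b))" for a b
  proof -
    let ?z = "\<lambda>t. a + t *s b"
    have 1: "((\<lambda>t. u (?z t)) has_derivative
       (\<lambda>h. Re h * u' (?z t) b + Im h * u' (?z t) (\<i> *s b))) (at t)" if "?z t \<in> D" for t
      using has_derivative_compose[OF has_derivative_vector_scalar_left u'[OF that]]
      by (simp add: blinfun.add_right blinfun.scaleR_right)
    have 2: "((\<lambda>t. u' (?z t) v) has_derivative
       (\<lambda>h. Re h * u'' (?z t) b v + Im h * u'' (?z t) (\<i> *s b) v)) (at t)" if "?z t \<in> D" for t v
    proof -
      have "((\<lambda>t. u' (?z t)) has_derivative
          (\<lambda>h. u'' (?z t) (Re h *\<^sub>R b + Im h *\<^sub>R (\<i> *s b)))) (at t)"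
        by (rule has_derivative_compose[OF has_derivative_vector_scalar_left u''[OF that]])
      then show ?thesis
        by (auto intro!: derivative_eq_intros simp: blinfun.add_right blinfun.scaleR_right
            blinfun.add_left blinfun.scaleR_left)
    qed
    have "continuous_on {t. ?z t \<in> D} ?z"
      by (rule has_derivative_continuous_on[OF has_derivative_at_withinI[OF has_derivative_vector_scalar_left]])
    then have 3: "continuous_on {t. ?z t \<in> D} (\<lambda>t. u'' (?z t) v w)" for v w
      by (intro blinfun.continuous_on continuous_on_const continuous_on_compose2[OF cont]) auto
    interpret planar_C2 "\<lambda>t. u (?z t)" "\<lambda>t. u' (?z t) b" "\<lambda>t. u' (?z t) (\<i> *s b)"
      "\<lambda>t. u'' (?z t) b b" "\<lambda>t. u'' (?z t) (\<i> *s b) b" "\<lambda>t. u'' (?z t) b (\<i> *s b)"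
      "\<lambda>t. u'' (?z t) (\<i> *s b) (\<i> *s b)" "{t. ?z t \<in> D}"
      by standard (use 1 2 3 in auto)
    show ?thesis
      by (rule subharmonic_on_iff_laplacian_nonneg[OF open_complex_line[OF D]])
  qed
  have "continuous_on D u"
    by (rule has_derivative_continuous_on[OF has_derivative_at_withinI[OF u']])
  then have "usc_on D u"
    unfolding usc_on_def using continuous_openin_preimage_gen[OF _ open_lessThan]
    by (fastforce simp: vimage_def Int_def)
  then have "plurisubharmonic_on D u \<longleftrightarrow> (\<forall>a b t. a + t *s b \<in> D \<longrightarrow>
      0 \<le> u'' (a + t *s b) b b + u'' (a + t *s b) (\<i> *s b) (\<i> *s b))"
    unfolding plurisubharmonic_on_def sub by blast
  also have "\<dots> \<longleftrightarrow> (\<forall>z\<in>D. \<forall>b. 0 \<le> u'' z b b + u'' z (\<i> *s b) (\<i> *s b))"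
  proof
    assume *: "\<forall>a b t. a + t *s b \<in> D \<longrightarrow>
      0 \<le> u'' (a + t *s b) b b + u'' (a + t *s b) (\<i> *s b) (\<i> *s b)"
    \<comment> \<open>Taking a = z and t = 0 reaches every point together with every
      direction.\<close>
    show "\<forall>z\<in>D. \<forall>b. 0 \<le> u'' z b b + u'' z (\<i> *s b) (\<i> *s b)"
      using *[rule_format, of _ 0] by simp
  qed blast
  finally show ?thesis .
qed

lemma has_derivative_dzbar:
  assumes "z \<in> D"
  shows "(dzbar B (\<lambda>w. of_real (u w)) has_derivative
    (\<lambda>y. (of_real (u'' z y (axis B 1)) + \<i> * of_real (u'' z y (axis B \<i>))) / 2)) (at z)"
proof -
  have eq: "(of_real (u' w (axis B 1)) + \<i> * of_real (u' w (axis B \<i>))) / 2 = dzbar B (\<lambda>w. of_real (u w)) w"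
    if "w \<in> D" for w
    by (rule dzbar_eqI[symmetric]) (use u'[OF that] in \<open>auto intro!: derivative_eq_intros\<close>)
  have "((\<lambda>w. (of_real (u' w (axis B 1)) + \<i> * of_real (u' w (axis B \<i>))) / 2 :: complex) has_derivative
    (\<lambda>y. (of_real (u'' z y (axis B 1)) + \<i> * of_real (u'' z y (axis B \<i>))) / 2)) (at z)"
    using u''[OF assms] by (auto intro!: derivative_eq_intros simp: blinfun.zero_right)
  then show ?thesis
    by (rule has_derivative_transform_within_open[OF _ D assms]) (rule eq)
qed

lemma complex_hessian_nth:
  assumes "z \<in> D"
  shows "complex_hessian u z $ A $ B =
    ((of_real (u'' z (axis A 1) (axis B 1)) + \<i> * of_real (u'' z (axis A 1) (axis B \<i>))) / 2 -
     \<i> * ((of_real (u'' z (axis A \<i>) (axis B 1)) + \<i> * of_real (u'' z (axis A \<i>) (axis B \<i>))) / 2)) / 2"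
  unfolding complex_hessian_def vec_lambda_beta by (rule dz_eqI[OF has_derivative_dzbar[OF assms]])

text \<open>Since \<open>u\<close> is real, conjugation only swaps the order of differentiation,
  which the symmetry of the second derivative undoes.\<close>

lemma hermitian_complex_hessian:
  assumes "z \<in> D"
  shows "hermitian (complex_hessian u z)"
proof -
  note sym = symmetric_second_derivative[OF D assms u' u'' cont]
  show ?thesis
    unfolding hermitian_def
  proof (intro allI)
    fix A B
    show "complex_hessian u z $ A $ B = cnj (complex_hessian u z $ B $ A)"
      unfolding complex_hessian_nth[OF assms]
      by (simp add: complex_eq_iff sym[of "axis B 1" "axis A 1"] sym[of "axis B 1" "axis A \<i>"]
          sym[of "axis B \<i>" "axis A 1"] sym[of "axis B \<i>" "axis A \<i>"])
  qed
qed

text \<open>Summation over A extracts the complex-linear part of \<open>u''\<close> in its first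
  argument, summation over B the conjugate-linear part in the second. The two halves give the factor
  4, and the mixed values at \<open>v\<close> and \<open>\<i> *s v\<close> enter with a factor \<i>,
  hence vanish in the real part.\<close>

lemma levi_form:
  assumes "z \<in> D"
  shows "4 * Re (\<Sum>A\<in>UNIV. \<Sum>B\<in>UNIV. complex_hessian u z $ A $ B * v $ A * cnj (v $ B)) =
    u'' z v v + u'' z (\<i> *s v) (\<i> *s v)" (is "4 * Re ?L = _")
proof -
  define g where "g B y = (of_real (u'' z y (axis B 1)) + \<i> * of_real (u'' z y (axis B \<i>))) / (2::complex)" for B y
  have lin: "linear (g B)" for B
    unfolding g_def by (rule has_derivative_linear[OF has_derivative_dzbar[OF assms]])
  have lin': "linear (\<lambda>w. of_real (u'' z y w) :: complex)" for y
    by (rule linearI)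
       (simp_all add: blinfun.add_right blinfun.scaleR_right scaleR_conv_of_real[where 'a = complex])
  have gsum: "(\<Sum>B\<in>UNIV. g B y * cnj (v $ B)) = (of_real (u'' z y v) + \<i> * of_real (u'' z y (\<i> *s v))) / 2" for y
    unfolding g_def by (rule complex_linear_part(2)[OF lin'])
  have "(\<Sum>A\<in>UNIV. \<Sum>B\<in>UNIV. complex_hessian u z $ A $ B * v $ A * cnj (v $ B)) =
      (\<Sum>B\<in>UNIV. (\<Sum>A\<in>UNIV. (g B (axis A 1) - \<i> * g B (axis A \<i>)) / 2 * v $ A) * cnj (v $ B))"
    unfolding complex_hessian_nth[OF assms] g_def by (subst sum.swap) (simp add: sum_distrib_right)
  also have "\<dots> = (\<Sum>B\<in>UNIV. (g B v - \<i> * g B (\<i> *s v)) / 2 * cnj (v $ B))"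
    unfolding complex_linear_part(1)[OF lin] ..
  also have "\<dots> = ((\<Sum>B\<in>UNIV. g B v * cnj (v $ B)) - \<i> * (\<Sum>B\<in>UNIV. g B (\<i> *s v) * cnj (v $ B))) / 2"
    by (simp add: sum_distrib_left sum_subtractf[symmetric] sum_divide_distrib algebra_simps diff_divide_distrib)
  finally have eq: "?L = ((of_real (u'' z v v) + \<i> * of_real (u'' z v (\<i> *s v))) / 2 -
      \<i> * ((of_real (u'' z (\<i> *s v) v) + \<i> * of_real (u'' z (\<i> *s v) (\<i> *s v))) / 2)) / 2"
    unfolding gsum .
  show ?thesis
    unfolding eq by simp
qed

end

lemma plurisubharmonic_on_iff_hessian:
  fixes D :: "(complex^'m::finite) set"
  assumes "open D" "C2_on D u"
  shows "plurisubharmonic_on D u \<longleftrightarrow> (\<forall>z\<in>D. pos_semidef (complex_hessian u z))"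
proof -
  obtain u' u'' where *: "\<And>x. x \<in> D \<Longrightarrow> (u has_derivative blinfun_apply (u' x)) (at x)"
    "\<And>x. x \<in> D \<Longrightarrow> (u' has_derivative blinfun_apply (u'' x)) (at x)" "continuous_on D u''"
    using C2_onE[OF assms(2)] by blast
  note D = assms(1)
  have "(0 \<le> u'' z v v + u'' z (\<i> *s v) (\<i> *s v)) \<longleftrightarrow>
      0 \<le> Re (\<Sum>A\<in>UNIV. \<Sum>B\<in>UNIV. complex_hessian u z $ A $ B * v $ A * cnj (v $ B))" if "z \<in> D" for z v
    using levi_form[OF D * that, of v] by linarith
  then have "(\<forall>z\<in>D. \<forall>v. 0 \<le> u'' z v v + u'' z (\<i> *s v) (\<i> *s v)) \<longleftrightarrow>
      (\<forall>z\<in>D. pos_semidef (complex_hessian u z))"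
    unfolding pos_semidef_def using hermitian_complex_hessian[OF D *] by blast
  then show ?thesis
    using plurisubharmonic_on_iff_levi[OF D *] by (rule trans[rotated])
qed

section \<open>Hopf gauges\<close>

definition affine_normsq :: "complex^'n::finite \<Rightarrow> real" where
  "affine_normsq \<zeta> = 1 + (\<Sum>\<beta>\<in>UNIV. (cmod (\<zeta> $ \<beta>))\<^sup>2)"

lemma affine_normsq_pos: "0 < affine_normsq \<zeta>"
  unfolding affine_normsq_def by (simp add: add_pos_nonneg sum_nonneg)

text \<open>Going through the squares of real and imaginary part covers points where the coordinate
  vanishes and the modulus itself is not differentiable.\<close>

lemma has_derivative_cmod_sq:
  "((\<lambda>\<zeta>. (cmod (\<zeta> $ \<alpha>))\<^sup>2) has_derivative (\<lambda>v. 2 * Re (cnj (\<zeta> $ \<alpha>) * v $ \<alpha>))) (at \<zeta>)"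
  for \<zeta> :: "complex^'n::finite"
proof -
  have "((\<lambda>\<zeta>. (Re (\<zeta> $ \<alpha>))\<^sup>2 + (Im (\<zeta> $ \<alpha>))\<^sup>2) has_derivative (\<lambda>v. 2 * Re (cnj (\<zeta> $ \<alpha>) * v $ \<alpha>))) (at \<zeta>)"
    by (auto intro!: derivative_eq_intros bounded_linear.has_derivative[OF bounded_linear_vec_nth]
        simp: algebra_simps)
  then show ?thesis
    by (simp add: cmod_power2)
qed

lemma has_derivative_affine_normsq:
  "(affine_normsq has_derivative (\<lambda>v. 2 * Re (\<Sum>\<beta>\<in>UNIV. cnj (\<zeta> $ \<beta>) * v $ \<beta>))) (at \<zeta>)"
proof -
  have "((\<lambda>\<zeta>. 1 + (\<Sum>\<beta>\<in>UNIV. (cmod (\<zeta> $ \<beta>))\<^sup>2)) has_derivative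
      (\<lambda>v. 0 + (\<Sum>\<beta>\<in>UNIV. 2 * Re (cnj (\<zeta> $ \<beta>) * v $ \<beta>)))) (at \<zeta>)"
    by (intro derivative_intros has_derivative_cmod_sq)
  then show ?thesis
    unfolding affine_normsq_def by (simp only: add_0_left Re_sum sum_distrib_left)
qed

lemma has_derivative_ln_affine_normsq:
  "((\<lambda>\<zeta>. ln (affine_normsq \<zeta>)) has_derivative
    (\<lambda>v. 2 * Re (\<Sum>\<beta>\<in>UNIV. cnj (\<zeta> $ \<beta>) / of_real (affine_normsq \<zeta>) * v $ \<beta>))) (at \<zeta>)"
proof -
  have "2 * Re (\<Sum>\<beta>\<in>UNIV. cnj (\<zeta> $ \<beta>) / of_real (affine_normsq \<zeta>) * v $ \<beta>) =
      2 * Re (\<Sum>\<beta>\<in>UNIV. cnj (\<zeta> $ \<beta>) * v $ \<beta>) * inverse (affine_normsq \<zeta>)" for v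
  proof -
    have "(\<Sum>\<beta>\<in>UNIV. cnj (\<zeta> $ \<beta>) / of_real (affine_normsq \<zeta>) * v $ \<beta>) =
        (\<Sum>\<beta>\<in>UNIV. cnj (\<zeta> $ \<beta>) * v $ \<beta>) / of_real (affine_normsq \<zeta>)"
      by (simp add: sum_divide_distrib)
    then show ?thesis
      by (simp only: Re_divide_of_real) (simp add: divide_inverse)
  qed
  then show ?thesis
    using has_derivative_ln[OF affine_normsq_pos[of \<zeta>] has_derivative_affine_normsq[of \<zeta>]]
    by (simp only:)
qed

text \<open>In any Hopf gauge \<open>d\<rho> = \<i> \<rho> Im (\<Sum> \<gamma>\<^sub>\<beta> d\<zeta>\<^sup>\<beta>)\<close> and
  \<open>\<partial>h/\<partial>\<zeta>\<^sup>\<beta> = \<gamma>\<^sub>\<beta> + cnj \<zeta>\<^sup>\<beta> / (1 + |\<zeta>|\<^sup>2)\<close> with holomorphic \<open>\<gamma>\<^sub>\<beta>\<close>; all that distinguishes the gauges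
  is \<open>\<gamma>\<close>, and it drops out of the frame.\<close>

definition gauge_connection ::
  "(complex^'n::finite) set \<Rightarrow> (complex^'n \<Rightarrow> complex) \<Rightarrow> (complex^'n \<Rightarrow> real) \<Rightarrow>
   ('n \<Rightarrow> complex^'n \<Rightarrow> complex) \<Rightarrow> bool" where
  "gauge_connection W \<rho> h \<gamma> \<longleftrightarrow> open W \<and> (\<forall>\<zeta>\<in>W. \<rho> \<zeta> \<noteq> 0 \<and>
     (\<rho> has_derivative (\<lambda>v. \<rho> \<zeta> * (\<i> * of_real (Im (\<Sum>\<beta>\<in>UNIV. \<gamma> \<beta> \<zeta> * v $ \<beta>))))) (at \<zeta>) \<and>
     (h has_derivative (\<lambda>v. 2 * Re (\<Sum>\<beta>\<in>UNIV.
        (\<gamma> \<beta> \<zeta> + cnj (\<zeta> $ \<beta>) / of_real (affine_normsq \<zeta>)) * v $ \<beta>))) (at \<zeta>) \<and>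
     (\<forall>\<beta>. \<exists>a. (\<gamma> \<beta> has_derivative (\<lambda>v. \<Sum>\<alpha>\<in>UNIV. a \<alpha> * v $ \<alpha>)) (at \<zeta>)))"

lemma gauge_connection_affine:
  assumes "open W"
  shows "gauge_connection W (\<lambda>\<zeta>. 1) (\<lambda>\<zeta>. ln (affine_normsq \<zeta>)) (\<lambda>\<beta> \<zeta>. 0)"
proof -
  have "((\<lambda>\<zeta>::complex^'a. 0::complex) has_derivative (\<lambda>v. \<Sum>\<alpha>\<in>UNIV. 0 * v $ \<alpha>)) (at \<zeta>)" for \<zeta>
    by simp
  then have "\<exists>a. ((\<lambda>\<zeta>::complex^'a. 0::complex) has_derivative (\<lambda>v. \<Sum>\<alpha>\<in>UNIV. a \<alpha> * v $ \<alpha>)) (at \<zeta>)" for \<zeta>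
    by (rule exI[of _ "\<lambda>_. 0"])
  then show ?thesis
    unfolding gauge_connection_def
    using assms has_derivative_ln_affine_normsq by (auto simp del: Re_sum Re_divide_of_real)
qed

text \<open>A continuous branch of a square root agrees near \<zeta> with a constant times the
  principal root of w / w(\<zeta>), which is differentiable because its argument is close to 1. The
  unimodular w = cnj \<zeta>^\<alpha> / |\<zeta>^\<alpha>| satisfies dw = -\<i> w Im
  (d\<zeta>^\<alpha> / \<zeta>^\<alpha>), and the root contributes the factor 1/2.\<close>

lemma has_derivative_unit_sqrt:
  fixes b :: "complex^'n::finite \<Rightarrow> complex"
  assumes W: "open W" "\<zeta> \<in> W" and b: "continuous_on W b"
    and sq: "\<And>\<xi>. \<xi> \<in> W \<Longrightarrow> \<xi> $ \<alpha> \<noteq> 0 \<and> (b \<xi>)\<^sup>2 = cnj (\<xi> $ \<alpha>) / of_real (cmod (\<xi> $ \<alpha>))"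
  shows "(b has_derivative (\<lambda>v. b \<zeta> * (\<i> * of_real (Im (- 1 / (2 * \<zeta> $ \<alpha>) * v $ \<alpha>))))) (at \<zeta>)"
proof -
  define w where "w \<xi> = cnj (\<xi> $ \<alpha>) / of_real (cmod (\<xi> $ \<alpha>))" for \<xi> :: "complex^'n"
  \<comment> \<open>Positive real part of the quotient selects one of the two roots; by continuity
    of \<open>b\<close> this holds on an open neighbourhood of \<zeta>.\<close>
  define V where "V = {\<xi> \<in> W. 0 < Re (b \<xi> / b \<zeta>)}"
  have z0: "\<zeta> $ \<alpha> \<noteq> 0" and w0: "w \<zeta> \<noteq> 0"
    using sq[OF W(2)] by (auto simp: w_def)
  have b0: "b \<zeta> \<noteq> 0"
    using sq[OF W(2)] by auto
  have "continuous_on W (\<lambda>\<xi>. Re (b \<xi> / b \<zeta>))"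
    by (intro continuous_intros b) (use b0 in auto)
  then have "open V"
    using continuous_open_preimage[OF _ W(1), of "\<lambda>\<xi>. Re (b \<xi> / b \<zeta>)" "{0<..}"]
    by (auto simp: V_def vimage_def Int_def)
  have \<zeta>V: "\<zeta> \<in> V"
    using W b0 by (simp add: V_def)
  have root: "b \<zeta> * csqrt (w \<xi> / w \<zeta>) = b \<xi>" if "\<xi> \<in> V" for \<xi>
  proof -
    have "w \<xi> / w \<zeta> = (b \<xi> / b \<zeta>)\<^sup>2"
      using sq[of \<xi>] sq[OF W(2)] that by (simp add: V_def w_def power_divide)
    moreover have "csqrt ((b \<xi> / b \<zeta>)\<^sup>2) = b \<xi> / b \<zeta>"
      using that by (intro csqrt_square) (simp add: V_def)
    ultimately show ?thesis
      using b0 by simp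
  qed
  have dn: "((\<lambda>\<xi>. cmod (\<xi> $ \<alpha>)) has_derivative (\<lambda>v. Re (cnj (\<zeta> $ \<alpha>) * v $ \<alpha>) / cmod (\<zeta> $ \<alpha>))) (at \<zeta>)"
  proof -
    have "((\<lambda>\<xi>. sqrt ((cmod (\<xi> $ \<alpha>))\<^sup>2)) has_derivative
        (\<lambda>v. 2 * Re (cnj (\<zeta> $ \<alpha>) * v $ \<alpha>) * (inverse (sqrt ((cmod (\<zeta> $ \<alpha>))\<^sup>2)) / 2))) (at \<zeta>)"
      by (rule has_derivative_real_sqrt[OF _ has_derivative_cmod_sq]) (use z0 in simp)
    moreover have "2 * x * (inverse y / 2) = x / y" for x y :: real
      by (simp add: field_simps)
    ultimately show ?thesis
      by (simp only: real_sqrt_abs abs_norm_cancel)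
  qed
  have dc: "((\<lambda>\<xi>. cnj (\<xi> $ \<alpha>)) has_derivative (\<lambda>v. cnj (v $ \<alpha>))) (at \<zeta>)"
    by (intro bounded_linear.has_derivative[OF bounded_linear_cnj]
        bounded_linear.has_derivative[OF bounded_linear_vec_nth] has_derivative_ident)
  have dw: "(w has_derivative (\<lambda>v. w \<zeta> * (- \<i> * of_real (Im (v $ \<alpha> / \<zeta> $ \<alpha>))))) (at \<zeta>)"
  proof -
    have "(w has_derivative (\<lambda>v. (cnj (v $ \<alpha>) * of_real (cmod (\<zeta> $ \<alpha>))
        - cnj (\<zeta> $ \<alpha>) * of_real (Re (cnj (\<zeta> $ \<alpha>) * v $ \<alpha>) / cmod (\<zeta> $ \<alpha>)))
        / (of_real (cmod (\<zeta> $ \<alpha>)) * of_real (cmod (\<zeta> $ \<alpha>))))) (at \<zeta>)"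
      unfolding w_def
      by (rule has_derivative_divide'[OF dc has_derivative_of_real[OF dn]]) (use z0 in simp)
    moreover have "(cnj y * of_real (cmod x) - cnj x * of_real (Re (cnj x * y) / cmod x))
        / (of_real (cmod x) * of_real (cmod x)) = cnj x / of_real (cmod x) * (- \<i> * of_real (Im (y / x)))"
      if "x \<noteq> 0" for x y
    proof -
      have n: "of_real (cmod x) * of_real (cmod x) = x * cnj x"
        by (metis complex_norm_square of_real_power power2_eq_square)
      have re: "of_real (Re (cnj x * y)) = (cnj x * y + x * cnj y) / 2"
        by (simp add: complex_eq_iff)
      have im: "\<i> * of_real (Im (y / x)) = (y / x - cnj y / cnj x) / 2"
        by (simp add: complex_eq_iff flip: complex_cnj_divide)
      have "(cnj y * of_real (cmod x) - cnj x * of_real (Re (cnj x * y) / cmod x)) * of_real (cmod x)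
          = cnj y * (of_real (cmod x) * of_real (cmod x)) - cnj x * of_real (Re (cnj x * y))"
        using that by (simp add: field_simps)
      also have "\<dots> = cnj x * (x * cnj x) * (- (\<i> * of_real (Im (y / x))))"
        unfolding n re im using that by (simp add: field_simps)
      finally show ?thesis
        using that unfolding n[symmetric] by (simp add: field_simps)
    qed
    ultimately show ?thesis
      using z0 by (simp add: w_def)
  qed
  have "((\<lambda>\<xi>. csqrt (w \<xi> / w \<zeta>)) has_derivative (\<lambda>v. 1 / 2 * (w \<zeta> * (- \<i> * of_real (Im (v $ \<alpha> / \<zeta> $ \<alpha>))) / w \<zeta>))) (at \<zeta>)"
  proof (rule has_derivative_compose[where f = "\<lambda>\<xi>. w \<xi> / w \<zeta>" and g = csqrt
        and g' = "(*) (1 / 2)"])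
    show "((\<lambda>\<xi>. w \<xi> / w \<zeta>) has_derivative (\<lambda>v. w \<zeta> * (- \<i> * of_real (Im (v $ \<alpha> / \<zeta> $ \<alpha>))) / w \<zeta>)) (at \<zeta>)"
      by (rule bounded_linear.has_derivative[OF bounded_linear_divide dw])
    show "(csqrt has_derivative (*) (1 / 2)) (at (w \<zeta> / w \<zeta>))"
      using has_field_derivative_csqrt[of 1] w0 by (simp add: has_field_derivative_def)
  qed
  then have "((\<lambda>\<xi>. b \<zeta> * csqrt (w \<xi> / w \<zeta>)) has_derivative
      (\<lambda>v. b \<zeta> * (1 / 2 * (w \<zeta> * (- \<i> * of_real (Im (v $ \<alpha> / \<zeta> $ \<alpha>))) / w \<zeta>)))) (at \<zeta>)"
    by (rule bounded_linear.has_derivative[OF bounded_linear_mult_right])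
  then have "(b has_derivative
      (\<lambda>v. b \<zeta> * (1 / 2 * (w \<zeta> * (- \<i> * of_real (Im (v $ \<alpha> / \<zeta> $ \<alpha>))) / w \<zeta>)))) (at \<zeta>)"
    by (rule has_derivative_transform_within_open[OF _ \<open>open V\<close> \<zeta>V]) (rule root)
  moreover have "1 / 2 * (w \<zeta> * (- \<i> * of_real (Im (y / \<zeta> $ \<alpha>))) / w \<zeta>) =
      \<i> * of_real (Im (- 1 / (2 * \<zeta> $ \<alpha>) * y))" for y
  proof -
    have "- 1 / (2 * \<zeta> $ \<alpha>) * y = of_real (- 1 / 2) * (y / \<zeta> $ \<alpha>)"
      by simp
    then have "Im (- 1 / (2 * \<zeta> $ \<alpha>) * y) = - 1 / 2 * Im (y / \<zeta> $ \<alpha>)"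
      by (metis Im_complex_of_real Re_complex_of_real add.right_neutral mult_zero_left times_complex.sel(2))
    then show ?thesis
      using w0 by (simp only:) simp
  qed
  ultimately show ?thesis
    by (simp only:)
qed

text \<open>The same \<gamma>_\<beta> = -1 / (2 \<zeta>^\<beta>) serves twice: it is the
  contribution of the square roots to the logarithmic derivative of the phase, and it is the
  \<zeta>^\<beta>-derivative of -ln |\<zeta>^\<beta>|.\<close>

lemma gauge_connection_nonvanishing:
  assumes W: "open W" and b: "\<And>\<alpha>. continuous_on W (b \<alpha>)"
    and sq: "\<And>\<alpha> \<zeta>. \<zeta> \<in> W \<Longrightarrow> \<zeta> $ \<alpha> \<noteq> 0 \<and> (b \<alpha> \<zeta>)\<^sup>2 = cnj (\<zeta> $ \<alpha>) / of_real (cmod (\<zeta> $ \<alpha>))"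
  shows "gauge_connection W (\<lambda>\<zeta>. \<Prod>\<alpha>\<in>UNIV. b \<alpha> \<zeta>)
       (\<lambda>\<zeta>. ln (affine_normsq \<zeta>) - (\<Sum>\<alpha>\<in>UNIV. ln (cmod (\<zeta> $ \<alpha>)))) (\<lambda>\<beta> \<zeta>. - 1 / (2 * \<zeta> $ \<beta>))"
  unfolding gauge_connection_def
proof (intro conjI ballI allI W)
  fix \<zeta> assume \<zeta>: "\<zeta> \<in> W"
  have b0: "b \<alpha> \<zeta> \<noteq> 0" and z0: "\<zeta> $ \<alpha> \<noteq> 0" for \<alpha>
    using sq[OF \<zeta>, of \<alpha>] by auto
  show "(\<Prod>\<alpha>\<in>UNIV. b \<alpha> \<zeta>) \<noteq> 0"
    using b0 by simp
  have "((\<lambda>\<zeta>. \<Prod>\<alpha>\<in>UNIV. b \<alpha> \<zeta>) has_derivative (\<lambda>v. \<Sum>\<alpha>\<in>UNIV.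
      b \<alpha> \<zeta> * (\<i> * of_real (Im (- 1 / (2 * \<zeta> $ \<alpha>) * v $ \<alpha>))) * (\<Prod>\<beta>\<in>UNIV - {\<alpha>}. b \<beta> \<zeta>))) (at \<zeta>)"
    by (rule has_derivative_prod[OF has_derivative_unit_sqrt[OF W \<zeta> b sq]])
  moreover have "b \<alpha> \<zeta> * x * (\<Prod>\<beta>\<in>UNIV - {\<alpha>}. b \<beta> \<zeta>) = (\<Prod>\<beta>\<in>UNIV. b \<beta> \<zeta>) * x" for \<alpha> x
    by (subst (2) prod.remove[of _ \<alpha>]) auto
  ultimately show "((\<lambda>\<zeta>. \<Prod>\<alpha>\<in>UNIV. b \<alpha> \<zeta>) has_derivative
     (\<lambda>v. (\<Prod>\<alpha>\<in>UNIV. b \<alpha> \<zeta>) * (\<i> * of_real (Im (\<Sum>\<beta>\<in>UNIV. - 1 / (2 * \<zeta> $ \<beta>) * v $ \<beta>))))) (at \<zeta>)"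
    by (simp only: sum_distrib_left Im_sum of_real_sum)
  have dl: "((\<lambda>\<zeta>. ln (cmod (\<zeta> $ \<alpha>))) has_derivative (\<lambda>v. - (2 * Re (- 1 / (2 * \<zeta> $ \<alpha>) * v $ \<alpha>)))) (at \<zeta>)" for \<alpha>
  proof -
    \<comment> \<open>The identity is used to rewrite whole functions, so it includes a vanishing
      coordinate; there both sides are 0 because \<open>ln 0 = 0\<close>.\<close>
    have eq: "ln (cmod (\<xi> $ \<alpha>)) = ln ((cmod (\<xi> $ \<alpha>))\<^sup>2) / 2" for \<xi> :: "complex^'a"
      by (cases "\<xi> $ \<alpha> = 0") (simp_all add: ln_realpow)
    have "((\<lambda>\<zeta>. ln ((cmod (\<zeta> $ \<alpha>))\<^sup>2) / 2) has_derivative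
        (\<lambda>v. 2 * Re (cnj (\<zeta> $ \<alpha>) * v $ \<alpha>) * inverse ((cmod (\<zeta> $ \<alpha>))\<^sup>2) / 2)) (at \<zeta>)"
      using z0 by (intro bounded_linear.has_derivative[OF bounded_linear_divide] has_derivative_ln
          has_derivative_cmod_sq) simp
    moreover have "2 * Re (cnj x * y) * inverse ((cmod x)\<^sup>2) / 2 = - (2 * Re (- 1 / (2 * x) * y))"
      if "x \<noteq> 0" for x y :: complex
    proof -
      have "- 1 / (2 * x) * y = of_real (- 1 / (2 * (cmod x)\<^sup>2)) * (cnj x * y)"
        using that complex_norm_square[of x] by (simp add: field_simps)
      then have "Re (- 1 / (2 * x) * y) = - 1 / (2 * (cmod x)\<^sup>2) * Re (cnj x * y)"
        by (metis Im_complex_of_real Re_complex_of_real diff_zero mult_zero_left times_complex.sel(1))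
      then show ?thesis
        by (simp only:) (simp add: field_simps)
    qed
    ultimately show ?thesis
      unfolding eq using z0[of \<alpha>] by (simp only: not_False_eq_True)
  qed
  have "((\<lambda>\<zeta>. ln (affine_normsq \<zeta>) - (\<Sum>\<alpha>\<in>UNIV. ln (cmod (\<zeta> $ \<alpha>)))) has_derivative
    (\<lambda>v. 2 * Re (\<Sum>\<beta>\<in>UNIV. cnj (\<zeta> $ \<beta>) / of_real (affine_normsq \<zeta>) * v $ \<beta>)
       - (\<Sum>\<alpha>\<in>UNIV. - (2 * Re (- 1 / (2 * \<zeta> $ \<alpha>) * v $ \<alpha>))))) (at \<zeta>)"
    by (intro has_derivative_diff has_derivative_sum has_derivative_ln_affine_normsq dl)
  moreover have "2 * Re (\<Sum>\<beta>\<in>UNIV. cnj (\<zeta> $ \<beta>) / of_real (affine_normsq \<zeta>) * v $ \<beta>)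
       - (\<Sum>\<alpha>\<in>UNIV. - (2 * Re (- 1 / (2 * \<zeta> $ \<alpha>) * v $ \<alpha>))) = 2 * Re (\<Sum>\<beta>\<in>UNIV.
        (- 1 / (2 * \<zeta> $ \<beta>) + cnj (\<zeta> $ \<beta>) / of_real (affine_normsq \<zeta>)) * v $ \<beta>)" for v
    by (simp only: Re_sum sum_distrib_left sum_negf diff_minus_eq_add sum.distrib[symmetric]
        distrib_right plus_complex.sel distrib_left) (simp only: add.commute)
  ultimately show "((\<lambda>\<zeta>. ln (affine_normsq \<zeta>) - (\<Sum>\<alpha>\<in>UNIV. ln (cmod (\<zeta> $ \<alpha>)))) has_derivative
    (\<lambda>v. 2 * Re (\<Sum>\<beta>\<in>UNIV.
        (- 1 / (2 * \<zeta> $ \<beta>) + cnj (\<zeta> $ \<beta>) / of_real (affine_normsq \<zeta>)) * v $ \<beta>))) (at \<zeta>)"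
    by (simp only:)
  fix \<beta>
  have "((\<lambda>\<zeta>. - 1 / (2 * \<zeta> $ \<beta>)) has_derivative (\<lambda>v. 1 / (2 * (\<zeta> $ \<beta>)\<^sup>2) * v $ \<beta>)) (at \<zeta>)"
    using z0[of \<beta>]
    by (auto intro!: derivative_eq_intros bounded_linear.has_derivative[OF bounded_linear_vec_nth]
        simp: field_simps power2_eq_square)
  moreover have "(\<Sum>\<alpha>\<in>UNIV. (if \<alpha> = \<beta> then 1 / (2 * (\<zeta> $ \<beta>)\<^sup>2) else 0) * v $ \<alpha>) = 1 / (2 * (\<zeta> $ \<beta>)\<^sup>2) * v $ \<beta>"
    for v :: "complex^'a"
    by (simp add: if_distrib[of "\<lambda>x. x * _"] cong: if_cong)
  ultimately show "\<exists>a. ((\<lambda>\<zeta>. - 1 / (2 * \<zeta> $ \<beta>)) has_derivative (\<lambda>v. \<Sum>\<alpha>\<in>UNIV. a \<alpha> * v $ \<alpha>)) (at \<zeta>)"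
    by (intro exI[of _ "\<lambda>\<alpha>. if \<alpha> = \<beta> then 1 / (2 * (\<zeta> $ \<beta>)\<^sup>2) else 0"]) (simp only:)
qed

text \<open>The second claim says that the partial derivatives of F are again holomorphic. The first
  derivative is complex-linear in its argument at every point, hence so is the second derivative in
  its second argument; symmetry transfers this to the direction of differentiation.\<close>

lemma holomorphic_vec_on_derivative:
  fixes F :: "complex^'n::finite \<Rightarrow> complex"
  assumes W: "open W" and F: "holomorphic_vec_on F W" and \<zeta>: "\<zeta> \<in> W"
  shows "(F has_derivative (\<lambda>v. \<Sum>\<beta>\<in>UNIV. dz \<beta> F \<zeta> * v $ \<beta>)) (at \<zeta>)"
    and "\<exists>a. (dz \<beta> F has_derivative (\<lambda>v. \<Sum>\<alpha>\<in>UNIV. a \<alpha> * v $ \<alpha>)) (at \<zeta>)"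
proof -
  obtain F' F'' where F': "\<And>x. x \<in> W \<Longrightarrow> (F has_derivative blinfun_apply (F' x)) (at x)"
    and F'': "\<And>x. x \<in> W \<Longrightarrow> (F' has_derivative blinfun_apply (F'' x)) (at x)"
    and cont: "continuous_on W F''"
    using C2_onE[of W F] F unfolding holomorphic_vec_on_def by blast
  have F'_eq: "F' x v = (\<Sum>\<beta>\<in>UNIV. dz \<beta> F x * v $ \<beta>)" if "x \<in> W" for x v
    using derivative_wirtinger[OF F'[OF that], of v] F that by (simp add: holomorphic_vec_on_def)
  show "(F has_derivative (\<lambda>v. \<Sum>\<beta>\<in>UNIV. dz \<beta> F \<zeta> * v $ \<beta>)) (at \<zeta>)"
    using F'[OF \<zeta>] F'_eq[OF \<zeta>] by (metis (no_types, lifting) ext)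
  have axis: "F' x (axis \<beta> 1) = dz \<beta> F x" if "x \<in> W" for x \<beta>
    unfolding F'_eq[OF that] by (simp add: axis_def if_distrib[of "\<lambda>x. _ * x"] cong: if_cong)
  have dF': "((\<lambda>x. F' x v) has_derivative (\<lambda>y. F'' \<zeta> y v)) (at \<zeta>)" for v
    using F''[OF \<zeta>] by (auto intro!: derivative_eq_intros simp: blinfun.zero_right)
  have ddz: "(dz \<beta> F has_derivative (\<lambda>y. F'' \<zeta> y (axis \<beta> 1))) (at \<zeta>)" for \<beta>
    by (rule has_derivative_transform_within_open[OF dF' W \<zeta> axis])
  have "((\<lambda>x. \<Sum>\<beta>\<in>UNIV. dz \<beta> F x * v $ \<beta>) has_derivative
      (\<lambda>y. \<Sum>\<alpha>\<in>UNIV. F'' \<zeta> y (axis \<alpha> 1) * v $ \<alpha>)) (at \<zeta>)" for v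
    by (intro has_derivative_sum bounded_linear.has_derivative[OF bounded_linear_mult_left] ddz)
  then have "((\<lambda>x. F' x v) has_derivative
      (\<lambda>y. \<Sum>\<alpha>\<in>UNIV. F'' \<zeta> y (axis \<alpha> 1) * v $ \<alpha>)) (at \<zeta>)" for v
    by (rule has_derivative_transform_within_open[OF _ W \<zeta>]) (simp add: F'_eq)
  \<comment> \<open>Both functions are derivatives of \<open>F' x v\<close>, one computed directly
    and one from its expansion in coordinates.\<close>
  then have "(\<lambda>y. F'' \<zeta> y v) = (\<lambda>y. \<Sum>\<alpha>\<in>UNIV. F'' \<zeta> y (axis \<alpha> 1) * v $ \<alpha>)" for v
    by (rule has_derivative_unique[OF dF'])
  then have "F'' \<zeta> y v = (\<Sum>\<alpha>\<in>UNIV. F'' \<zeta> y (axis \<alpha> 1) * v $ \<alpha>)" for y v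
    by (rule fun_cong)
  then have "F'' \<zeta> y (axis \<beta> 1) = (\<Sum>\<alpha>\<in>UNIV. F'' \<zeta> (axis \<beta> 1) (axis \<alpha> 1) * y $ \<alpha>)" for y
    by (subst symmetric_second_derivative[OF W \<zeta> F' F'' cont])
  then show "\<exists>a. (dz \<beta> F has_derivative (\<lambda>v. \<Sum>\<alpha>\<in>UNIV. a \<alpha> * v $ \<alpha>)) (at \<zeta>)"
    using ddz[of \<beta>] by (intro exI[of _ "\<lambda>\<alpha>. F'' \<zeta> (axis \<beta> 1) (axis \<alpha> 1)"]) (simp only:)
qed

text \<open>For holomorphic F the factor exp(\<i> Im F / 2) has logarithmic derivative \<i> Im
  (\<partial>F / 2), and Re F has Wirtinger derivatives \<partial>F / 2. Phase and basic function
  thus shift \<gamma> by the same amount.\<close>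

lemma gauge_connection_change:
  assumes c: "gauge_connection W \<rho> h \<gamma>" and F: "holomorphic_vec_on F W"
  shows "gauge_connection W (\<lambda>\<zeta>. \<rho> \<zeta> * exp (\<i> * of_real (Im (F \<zeta>)) / 2)) (\<lambda>\<zeta>. h \<zeta> + Re (F \<zeta>))
    (\<lambda>\<beta> \<zeta>. \<gamma> \<beta> \<zeta> + dz \<beta> F \<zeta> / 2)"
  unfolding gauge_connection_def
proof (intro conjI ballI allI)
  show W: "open W"
    using c by (simp add: gauge_connection_def)
  fix \<zeta> assume \<zeta>: "\<zeta> \<in> W"
  note dF = holomorphic_vec_on_derivative[OF W F \<zeta>]
  have \<rho>0: "\<rho> \<zeta> \<noteq> 0"
    and d\<rho>: "(\<rho> has_derivative (\<lambda>v. \<rho> \<zeta> * (\<i> * of_real (Im (\<Sum>\<beta>\<in>UNIV. \<gamma> \<beta> \<zeta> * v $ \<beta>))))) (at \<zeta>)"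
    and dh: "(h has_derivative (\<lambda>v. 2 * Re (\<Sum>\<beta>\<in>UNIV.
        (\<gamma> \<beta> \<zeta> + cnj (\<zeta> $ \<beta>) / of_real (affine_normsq \<zeta>)) * v $ \<beta>))) (at \<zeta>)"
    and d\<gamma>: "\<exists>a. (\<gamma> \<beta> has_derivative (\<lambda>v. \<Sum>\<alpha>\<in>UNIV. a \<alpha> * v $ \<alpha>)) (at \<zeta>)" for \<beta>
    using c \<zeta> by (auto simp: gauge_connection_def)
  show "\<rho> \<zeta> * exp (\<i> * of_real (Im (F \<zeta>)) / 2) \<noteq> 0"
    using \<rho>0 by simp
  let ?E = "\<lambda>\<zeta>. exp (\<i> * of_real (Im (F \<zeta>)) / 2)"
  have sum_add: "(\<Sum>\<beta>\<in>UNIV. (\<gamma> \<beta> \<zeta> + dz \<beta> F \<zeta> / 2) * v $ \<beta>) =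
      (\<Sum>\<beta>\<in>UNIV. \<gamma> \<beta> \<zeta> * v $ \<beta>) + (\<Sum>\<beta>\<in>UNIV. dz \<beta> F \<zeta> * v $ \<beta>) / 2" for v
    by (simp add: distrib_right sum.distrib sum_divide_distrib)
  have dE: "(?E has_derivative (\<lambda>v. ?E \<zeta> * (\<i> * of_real (Im (\<Sum>\<beta>\<in>UNIV. dz \<beta> F \<zeta> * v $ \<beta>)) / 2))) (at \<zeta>)"
  proof (rule has_derivative_compose[where f = "\<lambda>\<zeta>. \<i> * of_real (Im (F \<zeta>)) / 2" and g = exp
        and g' = "(*) (?E \<zeta>)"])
    show "((\<lambda>\<zeta>. \<i> * of_real (Im (F \<zeta>)) / 2) has_derivative
        (\<lambda>v. \<i> * of_real (Im (\<Sum>\<beta>\<in>UNIV. dz \<beta> F \<zeta> * v $ \<beta>)) / 2)) (at \<zeta>)"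
      by (intro bounded_linear.has_derivative[OF bounded_linear_divide]
          bounded_linear.has_derivative[OF bounded_linear_mult_right]
          bounded_linear.has_derivative[OF bounded_linear_of_real]
          bounded_linear.has_derivative[OF bounded_linear_Im] dF)
    show "(exp has_derivative (*) (?E \<zeta>)) (at (\<i> * of_real (Im (F \<zeta>)) / 2))"
      using DERIV_exp by (simp add: has_field_derivative_def)
  qed
  show "((\<lambda>\<zeta>. \<rho> \<zeta> * ?E \<zeta>) has_derivative (\<lambda>v. \<rho> \<zeta> * ?E \<zeta> *
      (\<i> * of_real (Im (\<Sum>\<beta>\<in>UNIV. (\<gamma> \<beta> \<zeta> + dz \<beta> F \<zeta> / 2) * v $ \<beta>))))) (at \<zeta>)"
    by (rule has_derivative_eq_rhs[OF has_derivative_mult[OF d\<rho> dE]])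
       (simp only: sum_add, simp add: algebra_simps del: Im_sum)
  have sum_add': "(\<Sum>\<beta>\<in>UNIV. (\<gamma> \<beta> \<zeta> + dz \<beta> F \<zeta> / 2 + cnj (\<zeta> $ \<beta>) / of_real (affine_normsq \<zeta>)) * v $ \<beta>) =
      (\<Sum>\<beta>\<in>UNIV. (\<gamma> \<beta> \<zeta> + cnj (\<zeta> $ \<beta>) / of_real (affine_normsq \<zeta>)) * v $ \<beta>)
      + (\<Sum>\<beta>\<in>UNIV. dz \<beta> F \<zeta> * v $ \<beta>) / 2" for v
    by (simp add: distrib_right sum.distrib sum_divide_distrib)
  show "((\<lambda>\<zeta>. h \<zeta> + Re (F \<zeta>)) has_derivative (\<lambda>v. 2 * Re (\<Sum>\<beta>\<in>UNIV.
      (\<gamma> \<beta> \<zeta> + dz \<beta> F \<zeta> / 2 + cnj (\<zeta> $ \<beta>) / of_real (affine_normsq \<zeta>)) * v $ \<beta>))) (at \<zeta>)"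
    by (rule has_derivative_eq_rhs[OF has_derivative_add[OF dh
          bounded_linear.has_derivative[OF bounded_linear_Re dF(1)]]])
       (simp only: sum_add', simp add: algebra_simps del: Re_sum)
  fix \<beta>
  obtain a b where "(\<gamma> \<beta> has_derivative (\<lambda>v. \<Sum>\<alpha>\<in>UNIV. a \<alpha> * v $ \<alpha>)) (at \<zeta>)"
    "(dz \<beta> F has_derivative (\<lambda>v. \<Sum>\<alpha>\<in>UNIV. b \<alpha> * v $ \<alpha>)) (at \<zeta>)"
    using d\<gamma>[of \<beta>] dF(2)[of \<beta>] by (elim exE)
  then have "((\<lambda>\<zeta>. \<gamma> \<beta> \<zeta> + dz \<beta> F \<zeta> / 2) has_derivative
      (\<lambda>v. (\<Sum>\<alpha>\<in>UNIV. a \<alpha> * v $ \<alpha>) + (\<Sum>\<alpha>\<in>UNIV. b \<alpha> * v $ \<alpha>) / 2)) (at \<zeta>)"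
    by (intro has_derivative_add bounded_linear.has_derivative[OF bounded_linear_divide])
  then show "\<exists>a. ((\<lambda>\<zeta>. \<gamma> \<beta> \<zeta> + dz \<beta> F \<zeta> / 2) has_derivative (\<lambda>v. \<Sum>\<alpha>\<in>UNIV. a \<alpha> * v $ \<alpha>)) (at \<zeta>)"
    by (intro exI[of _ "\<lambda>\<alpha>. a \<alpha> + b \<alpha> / 2"])
       (simp add: distrib_right sum.distrib sum_divide_distrib)
qed

lemma hopf_gauge_connection:
  "hopf_gauge W \<rho> h \<Longrightarrow> \<exists>\<gamma>. gauge_connection W \<rho> h \<gamma>"
proof (induction rule: hopf_gauge.induct)
  case (nonvanishing b)
  then show ?case
    using gauge_connection_nonvanishing[of W b] unfolding affine_normsq_def by blast
next
  case affine
  then show ?case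
    using gauge_connection_affine[of W] unfolding affine_normsq_def by blast
next
  case (change \<rho> h F)
  then show ?case
    using gauge_connection_change by blast
qed

section \<open>The Hopf frame\<close>

lemma sum_mult_axis: "(\<Sum>\<beta>\<in>UNIV. c \<beta> * axis \<alpha> x $ \<beta>) = c \<alpha> * (x::complex)"
  by (simp add: axis_def if_distrib[of "\<lambda>x. _ * x"] cong: if_cong)

lemma has_derivative_vec_lambda:
  fixes f :: "'m::finite \<Rightarrow> 'a::real_normed_vector \<Rightarrow> complex"
  assumes "\<And>C. (f C has_derivative f' C) (at x)"
  shows "((\<lambda>x. \<chi> C. f C x) has_derivative (\<lambda>y. \<chi> C. f' C y)) (at x)"
proof -
  have eq: "(\<chi> C. g C) = (\<Sum>C\<in>UNIV. axis C (g C))" for g :: "'m \<Rightarrow> complex"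
    by (simp add: vec_eq_iff axis_def if_distrib cong: if_cong)
  have "linear (\<lambda>z::complex. axis C z)" for C :: 'm
    by (rule linearI) (simp_all add: vec_eq_iff axis_def)
  then have "bounded_linear (\<lambda>z::complex. axis C z)" for C :: 'm
    by (simp add: linear_conv_bounded_linear)
  then show ?thesis
    unfolding eq by (intro has_derivative_sum bounded_linear.has_derivative[OF _ assms])
qed

text \<open>The fields act on curried functions of (r, \<theta>, \<zeta>), whereas Frechet
  derivatives live on the product space.\<close>

definition uncurry3 :: "('a \<Rightarrow> 'b \<Rightarrow> 'c \<Rightarrow> 'd) \<Rightarrow> 'a \<times> 'b \<times> 'c \<Rightarrow> 'd" where
  "uncurry3 f x = f (fst x) (fst (snd x)) (snd (snd x))"

definition hopf_field :: "(complex^'n::finite \<Rightarrow> real) \<Rightarrow> 'n option \<Rightarrow> 'n cfun \<Rightarrow> 'n cfun" where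
  "hopf_field h A = (case A of None \<Rightarrow> X0 | Some \<alpha> \<Rightarrow> X h \<alpha>)"

definition hopf_field_bar :: "(complex^'n::finite \<Rightarrow> real) \<Rightarrow> 'n option \<Rightarrow> 'n cfun \<Rightarrow> 'n cfun" where
  "hopf_field_bar h A = (case A of None \<Rightarrow> X0b | Some \<alpha> \<Rightarrow> Xb h \<alpha>)"

text \<open>The value of the frame fields on a function with total derivative \<open>F\<close>, where \<open>\<eta> \<alpha>\<close> stands for
  \<open>h\<^sub>\<alpha>\<close>.\<close>

definition frame ::
  "real \<Rightarrow> ('n \<Rightarrow> complex) \<Rightarrow> 'n::finite option \<Rightarrow> (real \<times> real \<times> (complex^'n) \<Rightarrow> complex) \<Rightarrow> complex" where
  "frame r \<eta> A F = (case A of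
     None \<Rightarrow> (F (1, 0, 0) - 2 * \<i> / of_real r * F (0, 1, 0)) / 2
   | Some \<alpha> \<Rightarrow> (F (0, 0, axis \<alpha> 1) - \<i> * F (0, 0, axis \<alpha> \<i>)) / 2 + \<i> * \<eta> \<alpha> * F (0, 1, 0))"

definition frame_bar ::
  "real \<Rightarrow> ('n \<Rightarrow> complex) \<Rightarrow> 'n::finite option \<Rightarrow> (real \<times> real \<times> (complex^'n) \<Rightarrow> complex) \<Rightarrow> complex" where
  "frame_bar r \<eta> A F = (case A of
     None \<Rightarrow> (F (1, 0, 0) + 2 * \<i> / of_real r * F (0, 1, 0)) / 2
   | Some \<alpha> \<Rightarrow> (F (0, 0, axis \<alpha> 1) + \<i> * F (0, 0, axis \<alpha> \<i>)) / 2 - \<i> * cnj (\<eta> \<alpha>) * F (0, 1, 0))"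

text \<open>The coefficients of the two frames are conjugate to each other, so each barred
  computation follows from an unbarred one and conversely.\<close>

lemma frame_cnj: "frame r \<eta> A (\<lambda>y. cnj (F y)) = cnj (frame_bar r \<eta> A F)"
  and frame_bar_cnj: "frame_bar r \<eta> A (\<lambda>y. cnj (F y)) = cnj (frame r \<eta> A F)"
  by (auto simp: frame_def frame_bar_def split: option.split)

lemma frame_add: "frame r \<eta> A (\<lambda>y. F y + G y) = frame r \<eta> A F + frame r \<eta> A G"
  and frame_mult: "frame r \<eta> A (\<lambda>y. a * F y) = a * frame r \<eta> A F"
  by (auto simp: frame_def algebra_simps add_divide_distrib diff_divide_distrib split: option.split)

lemma frame_bar_add: "frame_bar r \<eta> A (\<lambda>y. F y + G y) = frame_bar r \<eta> A F + frame_bar r \<eta> A G"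
  and frame_bar_mult: "frame_bar r \<eta> A (\<lambda>y. a * F y) = a * frame_bar r \<eta> A F"
  by (auto simp: frame_bar_def algebra_simps add_divide_distrib diff_divide_distrib split: option.split)

lemma frame_sum: "finite I \<Longrightarrow> frame r \<eta> A (\<lambda>y. \<Sum>C\<in>I. F C y) = (\<Sum>C\<in>I. frame r \<eta> A (F C))"
  by (induction I rule: finite_induct) (auto simp: frame_add, auto simp: frame_def split: option.split)

lemma hopf_derivative_eqI:
  fixes f :: "'n::finite cfun"
  assumes "(uncurry3 f has_derivative F) (at (r, \<theta>, \<zeta>))"
  shows d_r_eqI: "d_r f r \<theta> \<zeta> = F (1, 0, 0)"
    and d_theta_eqI: "d_theta f r \<theta> \<zeta> = F (0, 1, 0)"
    and has_derivative_slice: "(f r \<theta> has_derivative (\<lambda>v. F (0, 0, v))) (at \<zeta>)"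
proof -
  have cmul: "F (c *\<^sub>R y) = c *\<^sub>R F y" for c y
    using has_derivative_linear[OF assms] by (rule linear_cmul)
  have "F (s, 0, 0) = s *\<^sub>R F (1, 0, 0)" "F (0, s, 0) = s *\<^sub>R F (0, 1, 0)" for s
    using cmul[of s "(1, 0, 0)"] cmul[of s "(0, 1, 0)"] by simp_all
  then have lin: "(\<lambda>s. F (s, 0, 0)) = (\<lambda>s. s *\<^sub>R F (1, 0, 0))" "(\<lambda>s. F (0, s, 0)) = (\<lambda>s. s *\<^sub>R F (0, 1, 0))"
    by blast+
  have "((\<lambda>s. uncurry3 f (s, \<theta>, \<zeta>)) has_derivative (\<lambda>s. F (s, 0, 0))) (at r)"
    by (rule has_derivative_compose[where f = "\<lambda>s. (s, \<theta>, \<zeta>)" and g = "uncurry3 f" and g' = F])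
       (intro has_derivative_Pair has_derivative_ident has_derivative_const, rule assms)
  then have "((\<lambda>s. f s \<theta> \<zeta>) has_vector_derivative F (1, 0, 0)) (at r)"
    unfolding has_vector_derivative_def uncurry3_def fst_conv snd_conv lin .
  then show "d_r f r \<theta> \<zeta> = F (1, 0, 0)"
    unfolding d_r_def by (rule vector_derivative_at)
  have "((\<lambda>s. uncurry3 f (r, s, \<zeta>)) has_derivative (\<lambda>s. F (0, s, 0))) (at \<theta>)"
    by (rule has_derivative_compose[where f = "\<lambda>s. (r, s, \<zeta>)" and g = "uncurry3 f" and g' = F])
       (intro has_derivative_Pair has_derivative_ident has_derivative_const, rule assms)
  then have "((\<lambda>s. f r s \<zeta>) has_vector_derivative F (0, 1, 0)) (at \<theta>)"
    unfolding has_vector_derivative_def uncurry3_def fst_conv snd_conv lin .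
  then show "d_theta f r \<theta> \<zeta> = F (0, 1, 0)"
    unfolding d_theta_def by (rule vector_derivative_at)
  have "((\<lambda>\<zeta>. uncurry3 f (r, \<theta>, \<zeta>)) has_derivative (\<lambda>v. F (0, 0, v))) (at \<zeta>)"
    by (rule has_derivative_compose[where f = "\<lambda>\<zeta>. (r, \<theta>, \<zeta>)" and g = "uncurry3 f" and g' = F])
       (intro has_derivative_Pair has_derivative_ident has_derivative_const, rule assms)
  then show "(f r \<theta> has_derivative (\<lambda>v. F (0, 0, v))) (at \<zeta>)"
    by (simp add: uncurry3_def)
qed

lemma hopf_field_eqI:
  assumes "(uncurry3 f has_derivative F) (at (r, \<theta>, \<zeta>))"
    and "\<And>\<alpha>. dz \<alpha> (\<lambda>\<xi>. of_real (h \<xi>)) \<zeta> = \<eta> \<alpha>"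
  shows "hopf_field h A f r \<theta> \<zeta> = frame r \<eta> A F"
  using assms
  by (auto simp: hopf_field_def frame_def X0_def X_def hopf_derivative_eqI[OF assms(1)]
      dz_eqI[OF has_derivative_slice[OF assms(1)]] split: option.split)

lemma hopf_field_bar_eqI:
  assumes "(uncurry3 f has_derivative F) (at (r, \<theta>, \<zeta>))"
    and "\<And>\<alpha>. dzbar \<alpha> (\<lambda>\<xi>. of_real (h \<xi>)) \<zeta> = cnj (\<eta> \<alpha>)"
  shows "hopf_field_bar h A f r \<theta> \<zeta> = frame_bar r \<eta> A F"
  using assms
  by (auto simp: hopf_field_bar_def frame_bar_def X0b_def Xb_def hopf_derivative_eqI[OF assms(1)]
      dzbar_eqI[OF has_derivative_slice[OF assms(1)]] split: option.split)

text \<open>z^0 is a product of four factors; in this form its derivative is z^0 times a sum of four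
  logarithmic derivatives.\<close>

lemma has_log_derivative_mult:
  fixes f g :: "'a::real_normed_vector \<Rightarrow> complex"
  assumes "(f has_derivative (\<lambda>y. f x * a y)) (at x)" "(g has_derivative (\<lambda>y. g x * b y)) (at x)"
  shows "((\<lambda>x. f x * g x) has_derivative (\<lambda>y. f x * g x * (a y + b y))) (at x)"
  by (rule has_derivative_eq_rhs[OF has_derivative_mult[OF assms]]) (simp add: algebra_simps)

lemma has_log_derivative_inverse:
  fixes f :: "'a::real_normed_vector \<Rightarrow> complex"
  assumes "(f has_derivative (\<lambda>y. f x * a y)) (at x)" "f x \<noteq> 0"
  shows "((\<lambda>x. inverse (f x)) has_derivative (\<lambda>y. inverse (f x) * (- a y))) (at x)"
  by (rule has_derivative_eq_rhs[OF Deriv.has_derivative_inverse[OF assms(2,1)]])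
     (use assms(2) in \<open>simp add: algebra_simps\<close>)

lemma has_derivative_lift:
  assumes "(g has_derivative g') (at \<zeta>)"
  shows "((\<lambda>x. g (snd (snd x))) has_derivative (\<lambda>y. g' (snd (snd y)))) (at (r, \<theta>, \<zeta>))"
  by (rule has_derivative_compose[where f = "\<lambda>x. snd (snd x)" and g = g])
     (use assms in \<open>auto intro!: derivative_eq_intros\<close>)

section \<open>Frame derivatives of the coordinate functions\<close>

definition affine_coord :: "('n option \<Rightarrow> 'n option) \<Rightarrow> 'n option \<Rightarrow> complex^'n \<Rightarrow> complex" where
  "affine_coord \<sigma> C \<zeta> = (case \<sigma> C of None \<Rightarrow> 1 | Some \<alpha> \<Rightarrow> \<zeta> $ \<alpha>)"

definition hopf_z0 :: "(complex^'n::finite \<Rightarrow> complex) \<Rightarrow> real \<times> real \<times> (complex^'n) \<Rightarrow> complex" where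
  "hopf_z0 \<rho> x = of_real (fst x) * exp (\<i> / 2 * of_real (fst (snd x))) * \<rho> (snd (snd x)) *
     inverse (of_real (sqrt (affine_normsq (snd (snd x)))))"

lemma hopf_map_eq:
  "uncurry3 (hopf_map \<sigma> \<rho>) x = (\<chi> C. affine_coord \<sigma> C (snd (snd x)) * hopf_z0 \<rho> x)"
  unfolding uncurry3_def hopf_map_def Let_def affine_coord_def hopf_z0_def affine_normsq_def divide_inverse
  by (auto simp: vec_eq_iff split: option.split)

text \<open>\<open>frame_coeff \<sigma> \<rho> A C\<close> is the value of the \<open>A\<close>-th frame field on the coordinate function \<open>z\<^sup>C\<close>.\<close>

definition frame_coeff ::
  "('n option \<Rightarrow> 'n option) \<Rightarrow> (complex^'n::finite \<Rightarrow> complex) \<Rightarrow> 'n option \<Rightarrow> 'n option \<Rightarrow>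
   real \<times> real \<times> (complex^'n) \<Rightarrow> complex" where
  "frame_coeff \<sigma> \<rho> A C x = (case A of
     None \<Rightarrow> hopf_z0 \<rho> x * affine_coord \<sigma> C (snd (snd x)) * inverse (of_real (fst x))
   | Some \<alpha> \<Rightarrow> hopf_z0 \<rho> x * ((if \<sigma> C = Some \<alpha> then 1 else 0) - affine_coord \<sigma> C (snd (snd x)) *
        (cnj (snd (snd x) $ \<alpha>) / of_real (affine_normsq (snd (snd x))))))"

lemma has_derivative_affine_coord:
  "((\<lambda>x. affine_coord \<sigma> C (snd (snd x))) has_derivative
     (\<lambda>y. case \<sigma> C of None \<Rightarrow> 0 | Some \<alpha> \<Rightarrow> snd (snd y) $ \<alpha>)) (at (r, \<theta>, \<zeta>))"
  for \<zeta> :: "complex^'n::finite"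
proof -
  have "((\<lambda>x::complex^'n. x $ \<alpha>) has_derivative (\<lambda>v. v $ \<alpha>)) (at \<zeta>)" for \<alpha>
    by (rule bounded_linear_imp_has_derivative[OF bounded_linear_vec_nth])
  from has_derivative_lift[OF this] show ?thesis
    by (cases "\<sigma> C") (simp_all add: affine_coord_def)
qed

text \<open>The function is the \<zeta>^\<beta>-derivative of ln (1 + |\<zeta>|^2), that is, the
  part of h_\<beta> common to all gauges. It is also the non-holomorphic factor in X_\<beta> z^C, so
  its derivative enters both the Hessian of h and the correction term.\<close>

lemma has_derivative_chordal:
  "((\<lambda>\<zeta>. cnj (\<zeta> $ \<beta>) / of_real (affine_normsq \<zeta>)) has_derivative
     (\<lambda>v. (cnj (v $ \<beta>) * of_real (affine_normsq \<zeta>) -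
           cnj (\<zeta> $ \<beta>) * of_real (2 * Re (\<Sum>\<alpha>\<in>UNIV. cnj (\<zeta> $ \<alpha>) * v $ \<alpha>))) /
          (of_real (affine_normsq \<zeta>) * of_real (affine_normsq \<zeta>)))) (at \<zeta>)"
proof (rule has_derivative_divide')
  show "((\<lambda>\<zeta>. cnj (\<zeta> $ \<beta>)) has_derivative (\<lambda>v. cnj (v $ \<beta>))) (at \<zeta>)"
    by (intro bounded_linear.has_derivative[OF bounded_linear_cnj]
        bounded_linear.has_derivative[OF bounded_linear_vec_nth] has_derivative_ident)
  show "((\<lambda>\<zeta>. of_real (affine_normsq \<zeta>) :: complex) has_derivative
      (\<lambda>v. of_real (2 * Re (\<Sum>\<alpha>\<in>UNIV. cnj (\<zeta> $ \<alpha>) * v $ \<alpha>)))) (at \<zeta>)"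
    by (rule has_derivative_of_real[OF has_derivative_affine_normsq])
  show "complex_of_real (affine_normsq \<zeta>) \<noteq> 0"
    using affine_normsq_pos[of \<zeta>] by simp
qed

text \<open>Closed form of the mixed derivative of ln (1 + |\<zeta>|^2) in \<zeta>^\<alpha> and cnj
  \<zeta>^\<beta>.\<close>

definition fubini_study :: "complex^'n::finite \<Rightarrow> 'n \<Rightarrow> 'n \<Rightarrow> complex" where
  "fubini_study \<zeta> \<alpha> \<beta> = ((if \<alpha> = \<beta> then 1 else 0) * of_real (affine_normsq \<zeta>) - cnj (\<zeta> $ \<alpha>) * \<zeta> $ \<beta>) /
     (of_real (affine_normsq \<zeta>) * of_real (affine_normsq \<zeta>))"

lemma cnj_fubini_study: "cnj (fubini_study \<zeta> \<alpha> \<beta>) = fubini_study \<zeta> \<beta> \<alpha>"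
  by (simp add: fubini_study_def)

locale hopf_chart =
  fixes W and \<rho> :: "complex^'n::finite \<Rightarrow> complex" and h \<gamma> and \<sigma> :: "'n option \<Rightarrow> 'n option"
  assumes conn: "gauge_connection W \<rho> h \<gamma>" and bij: "bij \<sigma>"
begin

definition \<eta> :: "complex^'n \<Rightarrow> 'n \<Rightarrow> complex" where
  "\<eta> \<zeta> \<alpha> = \<gamma> \<alpha> \<zeta> + cnj (\<zeta> $ \<alpha>) / of_real (affine_normsq \<zeta>)"

lemma open_W: "open W"
  using conn by (simp add: gauge_connection_def)

lemma connD:
  assumes "\<zeta> \<in> W"
  shows "\<rho> \<zeta> \<noteq> 0"
    and "(\<rho> has_derivative (\<lambda>v. \<rho> \<zeta> * (\<i> * of_real (Im (\<Sum>\<beta>\<in>UNIV. \<gamma> \<beta> \<zeta> * v $ \<beta>))))) (at \<zeta>)"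
    and "(h has_derivative (\<lambda>v. 2 * Re (\<Sum>\<beta>\<in>UNIV. \<eta> \<zeta> \<beta> * v $ \<beta>))) (at \<zeta>)"
    and "\<exists>a. (\<gamma> \<beta> has_derivative (\<lambda>v. \<Sum>\<alpha>\<in>UNIV. a \<alpha> * v $ \<alpha>)) (at \<zeta>)"
  using conn assms unfolding gauge_connection_def \<eta>_def by blast+

lemma wirtinger_h:
  assumes "\<zeta> \<in> W"
  shows "dz \<alpha> (\<lambda>\<xi>. of_real (h \<xi>)) \<zeta> = \<eta> \<zeta> \<alpha>"
    and "dzbar \<alpha> (\<lambda>\<xi>. of_real (h \<xi>)) \<zeta> = cnj (\<eta> \<zeta> \<alpha>)"
proof -
  have d: "((\<lambda>\<xi>. complex_of_real (h \<xi>)) has_derivative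
      (\<lambda>v. of_real (2 * Re (\<Sum>\<beta>\<in>UNIV. \<eta> \<zeta> \<beta> * v $ \<beta>)))) (at \<zeta>)"
    by (rule has_derivative_of_real[OF connD(3)[OF assms]])
  show "dz \<alpha> (\<lambda>\<xi>. of_real (h \<xi>)) \<zeta> = \<eta> \<zeta> \<alpha>" "dzbar \<alpha> (\<lambda>\<xi>. of_real (h \<xi>)) \<zeta> = cnj (\<eta> \<zeta> \<alpha>)"
    unfolding dz_eqI[OF d] dzbar_eqI[OF d] sum_mult_axis by (simp_all add: complex_eq_iff)
qed

text \<open>The family \<gamma> is holomorphic, so its conjugate is killed by the unbarred
  derivative and the mixed Hessian of h is the same in every gauge.\<close>

lemma mixed_derivative_h:
  assumes "\<zeta> \<in> W"
  shows "dz \<alpha> (dzbar \<beta> (\<lambda>\<xi>. of_real (h \<xi>))) \<zeta> = fubini_study \<zeta> \<alpha> \<beta>"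
proof -
  obtain a where a: "(\<gamma> \<beta> has_derivative (\<lambda>v. \<Sum>\<alpha>\<in>UNIV. a \<alpha> * v $ \<alpha>)) (at \<zeta>)"
    using connD(4)[OF assms] by blast
  let ?q = "\<lambda>v. (cnj (v $ \<beta>) * of_real (affine_normsq \<zeta>) -
           cnj (\<zeta> $ \<beta>) * of_real (2 * Re (\<Sum>\<alpha>\<in>UNIV. cnj (\<zeta> $ \<alpha>) * v $ \<alpha>))) /
          (of_real (affine_normsq \<zeta>) * of_real (affine_normsq \<zeta>))"
  have "((\<lambda>\<zeta>. cnj (\<eta> \<zeta> \<beta>)) has_derivative (\<lambda>v. cnj ((\<Sum>\<alpha>\<in>UNIV. a \<alpha> * v $ \<alpha>) + ?q v))) (at \<zeta>)"
    unfolding \<eta>_def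
    by (intro bounded_linear.has_derivative[OF bounded_linear_cnj] has_derivative_add a has_derivative_chordal)
  then have d: "(dzbar \<beta> (\<lambda>\<xi>. of_real (h \<xi>)) has_derivative
      (\<lambda>v. cnj ((\<Sum>\<alpha>\<in>UNIV. a \<alpha> * v $ \<alpha>) + ?q v))) (at \<zeta>)"
    by (rule has_derivative_transform_within_open[OF _ open_W assms]) (simp add: wirtinger_h)
  have N: "complex_of_real (affine_normsq \<zeta>) \<noteq> 0"
    using affine_normsq_pos[of \<zeta>] by simp
  have re: "complex_of_real (2 * Re w) = w + cnj w" for w
    by (simp add: complex_eq_iff)
  show ?thesis
    unfolding dz_eqI[OF d] sum_mult_axis fubini_study_def re
    using N by (auto simp: axis_def field_simps)
qed

text \<open>The four summands are the logarithmic derivatives of r, of exp(\<i> \<theta> / 2), of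
  the phase and of (1 + |\<zeta>|^2)^(-1/2).\<close>

lemma has_derivative_z0:
  assumes "0 < r" "\<zeta> \<in> W"
  shows "(hopf_z0 \<rho> has_derivative (\<lambda>y. hopf_z0 \<rho> (r, \<theta>, \<zeta>) *
    (of_real (fst y / r) + \<i> / 2 * of_real (fst (snd y)) + \<i> * of_real (Im (\<Sum>\<beta>\<in>UNIV. \<gamma> \<beta> \<zeta> * snd (snd y) $ \<beta>))
     + - of_real (Re (\<Sum>\<beta>\<in>UNIV. cnj (\<zeta> $ \<beta>) * snd (snd y) $ \<beta>) / affine_normsq \<zeta>)))) (at (r, \<theta>, \<zeta>))"
proof -
  let ?x = "(r, \<theta>, \<zeta>)"
  have 1: "((\<lambda>x. of_real (fst x)) has_derivative (\<lambda>y. of_real (fst ?x) * complex_of_real (fst y / r))) (at ?x)"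
    using assms(1) by (auto intro!: derivative_eq_intros)
  have 2: "((\<lambda>x. exp (\<i> / 2 * of_real (fst (snd x)))) has_derivative
      (\<lambda>y. exp (\<i> / 2 * of_real (fst (snd ?x))) * (\<i> / 2 * of_real (fst (snd y))))) (at ?x)"
  proof (rule has_derivative_compose[where f = "\<lambda>x. \<i> / 2 * of_real (fst (snd x))" and g = exp
        and g' = "(*) (exp (\<i> / 2 * of_real (fst (snd ?x))))"])
    show "((\<lambda>x. \<i> / 2 * of_real (fst (snd x))) has_derivative (\<lambda>y. \<i> / 2 * of_real (fst (snd y)))) (at ?x)"
      by (intro bounded_linear.has_derivative[OF bounded_linear_mult_right]
          bounded_linear.has_derivative[OF bounded_linear_of_real] has_derivative_fst has_derivative_snd
          has_derivative_ident)
    show "(exp has_derivative (*) (exp (\<i> / 2 * of_real (fst (snd ?x))))) (at (\<i> / 2 * of_real (fst (snd ?x))))"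
      using DERIV_exp by (simp add: has_field_derivative_def)
  qed
  have 3: "((\<lambda>x. \<rho> (snd (snd x))) has_derivative (\<lambda>y. \<rho> (snd (snd ?x)) *
      (\<i> * of_real (Im (\<Sum>\<beta>\<in>UNIV. \<gamma> \<beta> \<zeta> * snd (snd y) $ \<beta>))))) (at ?x)"
    using has_derivative_lift[OF connD(2)[OF assms(2)]] by simp
  have N: "0 < affine_normsq \<zeta>"
    by (rule affine_normsq_pos)
  have "((\<lambda>\<zeta>. sqrt (affine_normsq \<zeta>)) has_derivative (\<lambda>v. sqrt (affine_normsq \<zeta>) *
      (Re (\<Sum>\<beta>\<in>UNIV. cnj (\<zeta> $ \<beta>) * v $ \<beta>) / affine_normsq \<zeta>))) (at \<zeta>)"
  proof (rule has_derivative_eq_rhs[OF has_derivative_real_sqrt[OF N has_derivative_affine_normsq]], rule ext)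
    fix v
    have "2 * x * (inverse (sqrt y) / 2) = sqrt y * (x / y)" if "0 < y" for x y :: real
    proof -
      have "sqrt y * sqrt y = y" "sqrt y > 0"
        using that by simp_all
      then show ?thesis
        using that by (simp add: field_simps)
    qed
    then show "2 * Re (\<Sum>\<beta>\<in>UNIV. cnj (\<zeta> $ \<beta>) * v $ \<beta>) * (inverse (sqrt (affine_normsq \<zeta>)) / 2) =
        sqrt (affine_normsq \<zeta>) * (Re (\<Sum>\<beta>\<in>UNIV. cnj (\<zeta> $ \<beta>) * v $ \<beta>) / affine_normsq \<zeta>)"
      using N .
  qed
  from has_derivative_of_real[OF has_derivative_lift[OF this]]
  have 4: "((\<lambda>x. of_real (sqrt (affine_normsq (snd (snd x))))) has_derivative
      (\<lambda>y. of_real (sqrt (affine_normsq (snd (snd ?x)))) *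
      complex_of_real (Re (\<Sum>\<beta>\<in>UNIV. cnj (\<zeta> $ \<beta>) * snd (snd y) $ \<beta>) / affine_normsq \<zeta>))) (at ?x)"
    unfolding of_real_mult snd_conv .
  have 5: "complex_of_real (sqrt (affine_normsq (snd (snd ?x)))) \<noteq> 0"
    using N by simp
  have eq: "hopf_z0 \<rho> = (\<lambda>x. of_real (fst x) * exp (\<i> / 2 * of_real (fst (snd x))) * \<rho> (snd (snd x)) *
     inverse (of_real (sqrt (affine_normsq (snd (snd x))))))"
    by (rule ext) (rule hopf_z0_def)
  show ?thesis
    unfolding eq
    by (rule has_log_derivative_mult[OF has_log_derivative_mult[OF has_log_derivative_mult[OF 1 2] 3]
        has_log_derivative_inverse[OF 4 5]])
qed

end

lemma cnj_dz_of_real: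
  assumes "(u has_derivative u') (at z)"
  shows "cnj (dz A (\<lambda>w. of_real (u w)) z) = dzbar A (\<lambda>w. of_real (u w)) z"
proof -
  have d: "((\<lambda>w. complex_of_real (u w)) has_derivative (\<lambda>v. of_real (u' v))) (at z)"
    by (rule has_derivative_of_real[OF assms])
  show ?thesis
    unfolding dz_eqI[OF d] dzbar_eqI[OF d] by simp
qed

lemma frame_affine_coord:
  "frame r e A (\<lambda>y. case \<sigma> C of None \<Rightarrow> 0 | Some \<alpha> \<Rightarrow> snd (snd y) $ \<alpha>) =
     (case A of None \<Rightarrow> 0 | Some \<alpha> \<Rightarrow> if \<sigma> C = Some \<alpha> then 1 else 0)"
  and frame_bar_affine_coord:
  "frame_bar r e A (\<lambda>y. case \<sigma> C of None \<Rightarrow> 0 | Some \<alpha> \<Rightarrow> snd (snd y) $ \<alpha>) = 0"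
  by (auto simp: frame_def frame_bar_def axis_def split: option.split)

lemma frame_bar_chordal:
  fixes \<zeta> :: "complex^'n::finite" and \<beta> :: 'n
  defines "q \<equiv> \<lambda>v. (cnj (v $ \<beta>) * of_real (affine_normsq \<zeta>) -
           cnj (\<zeta> $ \<beta>) * of_real (2 * Re (\<Sum>\<alpha>\<in>UNIV. cnj (\<zeta> $ \<alpha>) * v $ \<alpha>))) /
          (of_real (affine_normsq \<zeta>) * of_real (affine_normsq \<zeta>))"
  shows "frame_bar r e A (\<lambda>y. q (snd (snd y))) =
    (case A of None \<Rightarrow> 0 | Some \<alpha> \<Rightarrow> cnj (fubini_study \<zeta> \<alpha> \<beta>))"
proof -
  have N: "complex_of_real (affine_normsq \<zeta>) \<noteq> 0"
    using affine_normsq_pos[of \<zeta>] by simp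
  have re: "complex_of_real (2 * Re w) = w + cnj w" for w
    by (simp add: complex_eq_iff)
  have q0: "q 0 = 0"
    by (simp add: q_def)
  have "(q (axis \<alpha> 1) + \<i> * q (axis \<alpha> \<i>)) / 2 = cnj (fubini_study \<zeta> \<alpha> \<beta>)" for \<alpha>
    unfolding q_def sum_mult_axis fubini_study_def re
    using N by (auto simp: axis_def field_simps)
  then show ?thesis
    by (auto simp: frame_bar_def q0 split: option.split)
qed

text \<open>The first order correction \<open>\<lambda>\<close> of \<open>S(u)\<close>.\<close>

definition frame_torsion :: "real \<Rightarrow> complex^'n::finite \<Rightarrow> 'n option \<Rightarrow> 'n option \<Rightarrow> complex" where
  "frame_torsion r \<zeta> A B = (case A of
     None \<Rightarrow> (case B of None \<Rightarrow> 1 / of_real (2 * r) | Some \<beta> \<Rightarrow> 0)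
   | Some \<alpha> \<Rightarrow> (case B of None \<Rightarrow> 0 | Some \<beta> \<Rightarrow> of_real r * fubini_study \<zeta> \<alpha> \<beta>))"

lemma cnj_frame_torsion: "cnj (frame_torsion r \<zeta> A B) = frame_torsion r \<zeta> B A"
  by (simp add: frame_torsion_def cnj_fubini_study split: option.split)

context hopf_chart
begin

definition z0_deriv :: "real \<Rightarrow> real \<Rightarrow> complex^'n \<Rightarrow> real \<times> real \<times> (complex^'n) \<Rightarrow> complex" where
  "z0_deriv r \<theta> \<zeta> y = hopf_z0 \<rho> (r, \<theta>, \<zeta>) *
    (of_real (fst y / r) + \<i> / 2 * of_real (fst (snd y)) + \<i> * of_real (Im (\<Sum>\<beta>\<in>UNIV. \<gamma> \<beta> \<zeta> * snd (snd y) $ \<beta>))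
     + - of_real (Re (\<Sum>\<beta>\<in>UNIV. cnj (\<zeta> $ \<beta>) * snd (snd y) $ \<beta>) / affine_normsq \<zeta>))"

lemma has_z0_deriv:
  assumes "0 < r" "\<zeta> \<in> W"
  shows "(hopf_z0 \<rho> has_derivative z0_deriv r \<theta> \<zeta>) (at (r, \<theta>, \<zeta>))"
  unfolding z0_deriv_def by (rule has_derivative_z0[OF assms])

text \<open>The angle contributes \<i> h_\<alpha> times \<i>/2, that is, -h_\<alpha>/2 with
  h_\<alpha> = \<gamma>_\<alpha> + cnj \<zeta>^\<alpha> / (1 + |\<zeta>|^2). This cancels the
  \<gamma>_\<alpha>/2 coming from the phase and doubles the contribution of the norm. For the barred
  field the same two contributions cancel completely.\<close>

lemma frame_z0:
  assumes "0 < r"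
  shows "frame r (\<eta> \<zeta>) A (z0_deriv r \<theta> \<zeta>) = hopf_z0 \<rho> (r, \<theta>, \<zeta>) *
    (case A of None \<Rightarrow> inverse (of_real r) | Some \<alpha> \<Rightarrow> - (cnj (\<zeta> $ \<alpha>) / of_real (affine_normsq \<zeta>)))"
  and frame_bar_z0: "frame_bar r (\<eta> \<zeta>) A (z0_deriv r \<theta> \<zeta>) = 0"
proof -
  have N: "affine_normsq \<zeta> > 0"
    by (rule affine_normsq_pos)
  have "frame r (\<eta> \<zeta>) A (\<lambda>y. of_real (fst y / r) + \<i> / 2 * of_real (fst (snd y)) + \<i> * of_real (Im (\<Sum>\<beta>\<in>UNIV. \<gamma> \<beta> \<zeta> * snd (snd y) $ \<beta>))
     + - of_real (Re (\<Sum>\<beta>\<in>UNIV. cnj (\<zeta> $ \<beta>) * snd (snd y) $ \<beta>) / affine_normsq \<zeta>)) =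
    (case A of None \<Rightarrow> inverse (of_real r) | Some \<alpha> \<Rightarrow> - (cnj (\<zeta> $ \<alpha>) / of_real (affine_normsq \<zeta>)))"
  proof (cases A)
    case None
    then show ?thesis
      using assms by (simp add: frame_def field_simps)
  next
    case (Some \<alpha>)
    have "((\<i> * of_real (Im g) - of_real (Re z / n)) - \<i> * (\<i> * of_real (Im (g * \<i>)) - of_real (Re (z * \<i>) / n))) / 2
        + \<i> * (g + z / of_real n) * (\<i> / 2) = - (z / of_real n)" if "n > 0" for g z n
      using that by (simp add: complex_eq_iff field_simps)
    from this[OF N, of "\<gamma> \<alpha> \<zeta>" "cnj (\<zeta> $ \<alpha>)"] Some show ?thesis
      unfolding frame_def Some option.case fst_conv snd_conv sum_mult_axis \<eta>_def by simp
  qed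
  then show "frame r (\<eta> \<zeta>) A (z0_deriv r \<theta> \<zeta>) = hopf_z0 \<rho> (r, \<theta>, \<zeta>) *
    (case A of None \<Rightarrow> inverse (of_real r) | Some \<alpha> \<Rightarrow> - (cnj (\<zeta> $ \<alpha>) / of_real (affine_normsq \<zeta>)))"
    unfolding z0_deriv_def frame_mult by (simp only:)
  have "frame_bar r (\<eta> \<zeta>) A (\<lambda>y. of_real (fst y / r) + \<i> / 2 * of_real (fst (snd y)) + \<i> * of_real (Im (\<Sum>\<beta>\<in>UNIV. \<gamma> \<beta> \<zeta> * snd (snd y) $ \<beta>))
     + - of_real (Re (\<Sum>\<beta>\<in>UNIV. cnj (\<zeta> $ \<beta>) * snd (snd y) $ \<beta>) / affine_normsq \<zeta>)) = 0"
  proof (cases A)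
    case None
    then show ?thesis
      using assms by (simp add: frame_bar_def field_simps)
  next
    case (Some \<alpha>)
    have "((\<i> * of_real (Im g) - of_real (Re z / n)) + \<i> * (\<i> * of_real (Im (g * \<i>)) - of_real (Re (z * \<i>) / n))) / 2
        - \<i> * cnj (g + z / of_real n) * (\<i> / 2) = 0" if "n > 0" for g z n
      using that by (simp add: complex_eq_iff field_simps)
    from this[OF N, of "\<gamma> \<alpha> \<zeta>" "cnj (\<zeta> $ \<alpha>)"] Some show ?thesis
      unfolding frame_bar_def Some option.case fst_conv snd_conv sum_mult_axis \<eta>_def by simp
  qed
  then show "frame_bar r (\<eta> \<zeta>) A (z0_deriv r \<theta> \<zeta>) = 0"
    unfolding z0_deriv_def frame_bar_mult by (simp only: mult_zero_right)
qed

definition coord_deriv ::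
  "real \<Rightarrow> real \<Rightarrow> complex^'n \<Rightarrow> 'n option \<Rightarrow> real \<times> real \<times> (complex^'n) \<Rightarrow> complex" where
  "coord_deriv r \<theta> \<zeta> C y = affine_coord \<sigma> C \<zeta> * z0_deriv r \<theta> \<zeta> y +
     hopf_z0 \<rho> (r, \<theta>, \<zeta>) * (case \<sigma> C of None \<Rightarrow> 0 | Some \<alpha> \<Rightarrow> snd (snd y) $ \<alpha>)"

lemma has_coord_deriv:
  assumes "0 < r" "\<zeta> \<in> W"
  shows "((\<lambda>x. affine_coord \<sigma> C (snd (snd x)) * hopf_z0 \<rho> x) has_derivative coord_deriv r \<theta> \<zeta> C) (at (r, \<theta>, \<zeta>))"
  by (rule has_derivative_eq_rhs[OF has_derivative_mult[OF has_derivative_affine_coord has_z0_deriv[OF assms]]])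
     (auto simp: fun_eq_iff coord_deriv_def)

lemma has_derivative_hopf_map:
  assumes "0 < r" "\<zeta> \<in> W"
  shows "(uncurry3 (hopf_map \<sigma> \<rho>) has_derivative (\<lambda>y. \<chi> C. coord_deriv r \<theta> \<zeta> C y)) (at (r, \<theta>, \<zeta>))"
proof -
  have eq: "uncurry3 (hopf_map \<sigma> \<rho>) = (\<lambda>x. \<chi> C. affine_coord \<sigma> C (snd (snd x)) * hopf_z0 \<rho> x)"
    by (rule ext) (rule hopf_map_eq)
  show ?thesis
    unfolding eq by (rule has_derivative_vec_lambda[OF has_coord_deriv[OF assms]])
qed

text \<open>Each z^C is the product of a holomorphic function of \<zeta> and z^0, both killed by the
  barred fields; hence the fields X_A are of type (1,0). The family \<gamma> no longer occurs in the
  coefficients.\<close>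

lemma frame_coord:
  assumes "0 < r"
  shows "frame r (\<eta> \<zeta>) A (coord_deriv r \<theta> \<zeta> C) = frame_coeff \<sigma> \<rho> A C (r, \<theta>, \<zeta>)"
    and frame_bar_coord: "frame_bar r (\<eta> \<zeta>) A (coord_deriv r \<theta> \<zeta> C) = 0"
  unfolding coord_deriv_def frame_add frame_mult frame_bar_add frame_bar_mult frame_z0[OF assms]
    frame_bar_z0[OF assms] frame_affine_coord frame_bar_affine_coord frame_coeff_def
  by (auto simp: algebra_simps split: option.split)

text \<open>This is the conjugate of the identity for X_A (cnj (X_B z^C)). Barred fields kill z^0
  and z^C, so they see only 1/r in X_0 z^C and only cnj \<zeta>^\<beta> / (1 + |\<zeta>|^2) in
  X_\<beta> z^C. What remains is a multiple of z^C = r X_0 z^C.\<close>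

lemma frame_coeff_derivative:
  assumes "0 < r" "\<zeta> \<in> W"
  obtains M where "(frame_coeff \<sigma> \<rho> B C has_derivative M) (at (r, \<theta>, \<zeta>))"
    and "\<And>A. frame_bar r (\<eta> \<zeta>) A M = - cnj (frame_torsion r \<zeta> A B) * frame_coeff \<sigma> \<rho> None C (r, \<theta>, \<zeta>)"
proof (cases B)
  case None
  define M where "M y = inverse (of_real r) * coord_deriv r \<theta> \<zeta> C y
     + affine_coord \<sigma> C \<zeta> * hopf_z0 \<rho> (r, \<theta>, \<zeta>) * (- inverse (of_real r) * inverse (of_real r) * of_real (fst y))" for y
  have eq: "frame_coeff \<sigma> \<rho> None C = (\<lambda>x. (affine_coord \<sigma> C (snd (snd x)) * hopf_z0 \<rho> x) * inverse (of_real (fst x)))"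
    by (rule ext) (simp add: frame_coeff_def)
  have "((\<lambda>x. inverse (complex_of_real (fst x))) has_derivative
      (\<lambda>y. - (inverse (of_real r) * of_real (fst y) * inverse (of_real r)))) (at (r, \<theta>, \<zeta>))"
    using Deriv.has_derivative_inverse[of "\<lambda>x. complex_of_real (fst x)" "(r, \<theta>, \<zeta>)" "\<lambda>y. of_real (fst y)"]
      assms(1) has_derivative_of_real[OF has_derivative_fst[OF has_derivative_ident]] by fastforce
  then have "(frame_coeff \<sigma> \<rho> None C has_derivative M) (at (r, \<theta>, \<zeta>))"
    unfolding eq M_def
    by (rule has_derivative_eq_rhs[OF has_derivative_mult[OF has_coord_deriv[OF assms]]])
       (simp add: fun_eq_iff algebra_simps)
  moreover have "frame_bar r (\<eta> \<zeta>) A M = - cnj (frame_torsion r \<zeta> A B) * frame_coeff \<sigma> \<rho> None C (r, \<theta>, \<zeta>)" for A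
    unfolding M_def frame_bar_add frame_bar_mult frame_bar_coord[OF assms(1)] frame_coeff_def frame_torsion_def None
    by (auto simp: frame_bar_def field_simps split: option.split)
  ultimately show thesis
    using that None by blast
next
  case (Some \<beta>)
  define q where "q v = (cnj (v $ \<beta>) * of_real (affine_normsq \<zeta>) -
           cnj (\<zeta> $ \<beta>) * of_real (2 * Re (\<Sum>\<alpha>\<in>UNIV. cnj (\<zeta> $ \<alpha>) * v $ \<alpha>))) /
          (of_real (affine_normsq \<zeta>) * of_real (affine_normsq \<zeta>))" for v
  define k :: complex where "k = (if \<sigma> C = Some \<beta> then 1 else 0)"
  \<comment> \<open>The product rule is grouped so that the barred fields annihilate the first two
    summands and only the third, non-holomorphic one survives.\<close>
  define M where "M y = (k * z0_deriv r \<theta> \<zeta> y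
     + (- (cnj (\<zeta> $ \<beta>) / of_real (affine_normsq \<zeta>))) * coord_deriv r \<theta> \<zeta> C y)
     + (- (affine_coord \<sigma> C \<zeta> * hopf_z0 \<rho> (r, \<theta>, \<zeta>))) * q (snd (snd y))" for y
  have eq: "frame_coeff \<sigma> \<rho> (Some \<beta>) C = (\<lambda>x. k * hopf_z0 \<rho> x - (affine_coord \<sigma> C (snd (snd x)) * hopf_z0 \<rho> x) *
      (cnj (snd (snd x) $ \<beta>) / of_real (affine_normsq (snd (snd x)))))"
    by (rule ext) (simp add: frame_coeff_def k_def algebra_simps)
  have "((\<lambda>x. cnj (snd (snd x) $ \<beta>) / of_real (affine_normsq (snd (snd x)))) has_derivative
      (\<lambda>y. q (snd (snd y)))) (at (r, \<theta>, \<zeta>))"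
    unfolding q_def by (rule has_derivative_lift[OF has_derivative_chordal])
  then have "(frame_coeff \<sigma> \<rho> (Some \<beta>) C has_derivative M) (at (r, \<theta>, \<zeta>))"
    unfolding eq M_def
    by (rule has_derivative_eq_rhs[OF has_derivative_diff[OF
          bounded_linear.has_derivative[OF bounded_linear_mult_right has_z0_deriv[OF assms]]
          has_derivative_mult[OF has_coord_deriv[OF assms]]]])
       (simp add: fun_eq_iff algebra_simps)
  moreover have "frame_bar r (\<eta> \<zeta>) A M = - cnj (frame_torsion r \<zeta> A B) * frame_coeff \<sigma> \<rho> None C (r, \<theta>, \<zeta>)" for A
    unfolding M_def frame_bar_add frame_bar_mult frame_bar_coord[OF assms(1)] frame_bar_z0[OF assms(1)]
      q_def frame_bar_chordal frame_coeff_def frame_torsion_def Some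
    using assms(1) by (auto simp: algebra_simps split: option.split)
  ultimately show thesis
    using that Some by blast
qed

text \<open>The field V = \<Sum> v_A X_A is assumed to annihilate every coordinate z^C. From V z^0 =
  0 it annihilates the quotients \<zeta>^\<alpha> too, and these give v_\<alpha> = 0; then V z^0 = 0
  reduces to v_0 / r = 0.\<close>

lemma frame_coeff_inj:
  fixes v :: "complex^('n option)"
  assumes "0 < r" "\<zeta> \<in> W" and zero: "\<And>C. (\<Sum>A\<in>UNIV. v $ A * frame_coeff \<sigma> \<rho> A C (r, \<theta>, \<zeta>)) = 0"
  shows "v = 0"
proof -
  define z where "z = hopf_z0 \<rho> (r, \<theta>, \<zeta>)"
  have z: "z \<noteq> 0"
    using assms(1) connD(1)[OF assms(2)] affine_normsq_pos[of \<zeta>] by (simp add: z_def hopf_z0_def)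
  have sum_option: "(\<Sum>A\<in>UNIV. f A) = f None + (\<Sum>\<alpha>\<in>UNIV. f (Some \<alpha>))" for f :: "'n option \<Rightarrow> complex"
    by (simp add: UNIV_option_conv sum.reindex)
  \<comment> \<open>\<open>T\<close> is the logarithmic derivative of z^0 along the field with
    components \<open>v\<close>.\<close>
  define T where "T = v $ None * inverse (of_real r)
      - (\<Sum>\<alpha>\<in>UNIV. v $ Some \<alpha> * (cnj (\<zeta> $ \<alpha>) / of_real (affine_normsq \<zeta>)))"
  have expand: "(\<Sum>A\<in>UNIV. v $ A * frame_coeff \<sigma> \<rho> A C (r, \<theta>, \<zeta>)) =
      z * ((\<Sum>\<alpha>\<in>UNIV. v $ Some \<alpha> * (if \<sigma> C = Some \<alpha> then 1 else 0)) + affine_coord \<sigma> C \<zeta> * T)" for C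
    unfolding sum_option T_def frame_coeff_def z_def
    by (simp add: right_diff_distrib distrib_left sum_subtractf sum_distrib_left mult.assoc mult.left_commute
        del: mult_cancel_left)
  obtain C0 where "\<sigma> C0 = None"
    using bij by (metis bij_pointE)
  then have T: "T = 0"
    using zero[of C0] z unfolding expand by (simp add: affine_coord_def)
  have vS: "v $ Some \<alpha> = 0" for \<alpha>
  proof -
    obtain C where "\<sigma> C = Some \<alpha>"
      using bij by (metis bij_pointE)
    then show ?thesis
      using zero[of C] z unfolding expand T
      by (simp add: if_distrib[of "\<lambda>x. _ * x"] cong: if_cong)
  qed
  then have "v $ None = 0"
    using T assms(1) by (simp add: T_def)
  then have "v $ A = 0" for A
    using vS by (cases A) auto
  then show ?thesis
    by (simp add: vec_eq_iff)
qed

end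

section \<open>The matrices in terms of the complex Hessian\<close>

text \<open>The form of S at v is the form of H at the vector with components \<Sum>_A v_A M_AC.
  This linear map is injective, hence bijective in finite dimension, so both forms take the same
  values and the same values on nonzero vectors.\<close>

lemma pos_congruence:
  fixes H S :: "complex^'m::finite^'m" and M :: "'m \<Rightarrow> 'm \<Rightarrow> complex"
  assumes H: "hermitian H"
    and S: "\<And>A B. S $ A $ B = (\<Sum>C\<in>UNIV. \<Sum>E\<in>UNIV. M A E * H $ E $ C * cnj (M B C))"
    and inj: "\<And>v :: complex^'m. (\<And>C. (\<Sum>A\<in>UNIV. v $ A * M A C) = 0) \<Longrightarrow> v = 0"
  shows "hermitian S" and "pos_semidef S \<longleftrightarrow> pos_semidef H" and "pos_def S \<longleftrightarrow> pos_def H"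
proof -
  have "S $ A $ B = cnj (S $ B $ A)" for A B
  proof -
    have H': "cnj (H $ E $ C) = H $ C $ E" for E C
      using H unfolding hermitian_def by metis
    have "cnj (S $ B $ A) = (\<Sum>C\<in>UNIV. \<Sum>E\<in>UNIV. M A C * H $ C $ E * cnj (M B E))"
      unfolding S by (simp add: H' mult_ac)
    also have "\<dots> = S $ A $ B"
      unfolding S by (rule sum.swap)
    finally show ?thesis ..
  qed
  then show herm: "hermitian S"
    unfolding hermitian_def by blast
  define T where "T v = (\<chi> C. \<Sum>A\<in>UNIV. v $ A * M A C)" for v :: "complex^'m"
  have "linear T"
    by (rule linearI) (simp_all add: T_def vec_eq_iff distrib_right sum.distrib scaleR_sum_right)
  moreover have "inj T"
    using \<open>linear T\<close> inj by (auto simp: linear_injective_0 T_def vec_eq_iff)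
  ultimately have surj: "surj T"
    by (rule linear_injective_imp_surjective) (rule refl)
  have T0: "T v = 0 \<longleftrightarrow> v = 0" for v
    using \<open>linear T\<close> \<open>inj T\<close> linear_injective_0 linear_0 by blast
  have form: "(\<Sum>A\<in>UNIV. \<Sum>B\<in>UNIV. S $ A $ B * v $ A * cnj (v $ B)) =
      (\<Sum>E\<in>UNIV. \<Sum>C\<in>UNIV. H $ E $ C * T v $ E * cnj (T v $ C))" for v
  proof -
    have "(\<Sum>E\<in>UNIV. \<Sum>C\<in>UNIV. H $ E $ C * T v $ E * cnj (T v $ C)) =
      (\<Sum>E\<in>UNIV. \<Sum>C\<in>UNIV. \<Sum>A\<in>UNIV. \<Sum>B\<in>UNIV. M A E * H $ E $ C * cnj (M B C) * v $ A * cnj (v $ B))"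
      unfolding T_def vec_lambda_beta cnj_sum sum_distrib_left sum_distrib_right
      by (rule sum.cong[OF refl], rule sum.cong[OF refl], rule trans[OF sum.swap]) (simp add: mult_ac)
    also have "\<dots> = (\<Sum>E\<in>UNIV. \<Sum>A\<in>UNIV. \<Sum>B\<in>UNIV. \<Sum>C\<in>UNIV. M A E * H $ E $ C * cnj (M B C) * v $ A * cnj (v $ B))"
      by (rule sum.cong[OF refl], rule trans[OF sum.swap], rule sum.cong[OF refl], rule sum.swap)
    also have "\<dots> = (\<Sum>A\<in>UNIV. \<Sum>B\<in>UNIV. \<Sum>E\<in>UNIV. \<Sum>C\<in>UNIV. M A E * H $ E $ C * cnj (M B C) * v $ A * cnj (v $ B))"
      by (rule trans[OF sum.swap], rule sum.cong[OF refl], rule sum.swap)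
    also have "\<dots> = (\<Sum>A\<in>UNIV. \<Sum>B\<in>UNIV. S $ A $ B * v $ A * cnj (v $ B))"
      unfolding S sum_distrib_right by (rule sum.cong[OF refl], rule sum.cong[OF refl], rule sum.swap)
    finally show ?thesis ..
  qed
  have "(\<forall>v. P (T v)) \<longleftrightarrow> (\<forall>w. P w)" for P
    using surj by (metis surjD)
  note all_T = this
  show "pos_semidef S \<longleftrightarrow> pos_semidef H"
    unfolding pos_semidef_def form using herm H
      all_T[of "\<lambda>w. 0 \<le> Re (\<Sum>E\<in>UNIV. \<Sum>C\<in>UNIV. H $ E $ C * w $ E * cnj (w $ C))"] by blast
  show "pos_def S \<longleftrightarrow> pos_def H"
    unfolding pos_def_def form using herm H T0
      all_T[of "\<lambda>w. w \<noteq> 0 \<longrightarrow> 0 < Re (\<Sum>E\<in>UNIV. \<Sum>C\<in>UNIV. H $ E $ C * w $ E * cnj (w $ C))"] by blast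
qed

section \<open>The chain rule in a Hopf chart\<close>

context hopf_chart
begin

context
  fixes D :: "(complex^('n option)) set" and u :: "complex^('n option) \<Rightarrow> real" and u' u''
  assumes D: "open D"
    and u': "\<And>x. x \<in> D \<Longrightarrow> (u has_derivative blinfun_apply (u' x)) (at x)"
    and u'': "\<And>x. x \<in> D \<Longrightarrow> (u' has_derivative blinfun_apply (u'' x)) (at x)"
    and cont: "continuous_on D u''"
begin

abbreviation \<Phi> :: "real \<times> real \<times> (complex^'n) \<Rightarrow> complex^('n option)" where
  "\<Phi> \<equiv> uncurry3 (hopf_map \<sigma> \<rho>)"

abbreviation U :: "'n cfun" where
  "U \<equiv> \<lambda>r \<theta> \<zeta>. of_real (u (hopf_map \<sigma> \<rho> r \<theta> \<zeta>))"

abbreviation chart_domain :: "(real \<times> real \<times> (complex^'n)) set" where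
  "chart_domain \<equiv> {x. 0 < fst x \<and> snd (snd x) \<in> W \<and> \<Phi> x \<in> D}"

text \<open>The matrices apply a field to the result of another field, so the formula for the inner
  field has to hold on a whole neighbourhood of the point.\<close>

lemma open_chart_domain: "open chart_domain"
proof -
  let ?V = "{x :: real \<times> real \<times> (complex^'n). 0 < fst x} \<inter> (\<lambda>x. snd (snd x)) -` W"
  have V: "open ?V"
    by (intro open_Int open_Collect_less continuous_intros open_vimage open_W)
  have "continuous_on ?V \<Phi>"
  proof (rule continuous_at_imp_continuous_on, rule ballI)
    fix x assume "x \<in> ?V"
    then have "(\<Phi> has_derivative (\<lambda>y. \<chi> C. coord_deriv (fst x) (fst (snd x)) (snd (snd x)) C y)) (at x)"
      using has_derivative_hopf_map[of "fst x" "snd (snd x)" "fst (snd x)"] by simp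
    then show "isCont \<Phi> x"
      by (rule has_derivative_continuous)
  qed
  then have "open (?V \<inter> \<Phi> -` D)"
    by (rule continuous_open_preimage[OF _ V D])
  moreover have "?V \<inter> \<Phi> -` D = chart_domain"
    by auto
  ultimately show ?thesis
    by simp
qed

text \<open>The chain rule expresses the differential of the pullback through those of z^C and cnj
  z^C, and an unbarred field kills the latter.\<close>

lemma hopf_field_pullback:
  assumes "(r, \<theta>, \<zeta>) \<in> chart_domain"
  shows "hopf_field h A U r \<theta> \<zeta> =
      (\<Sum>C\<in>UNIV. dz C (\<lambda>w. of_real (u w)) (\<Phi> (r, \<theta>, \<zeta>)) * frame_coeff \<sigma> \<rho> A C (r, \<theta>, \<zeta>))"
    and "hopf_field_bar h A U r \<theta> \<zeta> =
      (\<Sum>C\<in>UNIV. dzbar C (\<lambda>w. of_real (u w)) (\<Phi> (r, \<theta>, \<zeta>)) * cnj (frame_coeff \<sigma> \<rho> A C (r, \<theta>, \<zeta>)))"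
proof -
  let ?x = "(r, \<theta>, \<zeta>)"
  have r: "0 < r" and \<zeta>: "\<zeta> \<in> W" and \<Phi>: "\<Phi> ?x \<in> D"
    using assms by auto
  have uc: "((\<lambda>w. complex_of_real (u w)) has_derivative (\<lambda>v. of_real (u' (\<Phi> ?x) v))) (at (\<Phi> ?x))"
    by (rule has_derivative_of_real[OF u'[OF \<Phi>]])
  define F where "F y = complex_of_real (u' (\<Phi> ?x) (\<chi> C. coord_deriv r \<theta> \<zeta> C y))" for y
  have "uncurry3 U = (\<lambda>x. of_real (u (\<Phi> x)))"
    by (simp add: fun_eq_iff uncurry3_def)
  then have dU: "(uncurry3 U has_derivative F) (at ?x)"
    unfolding F_def
    using has_derivative_compose[OF has_derivative_hopf_map[OF r \<zeta>] uc]
    by simp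
  have F: "F = (\<lambda>y. \<Sum>C\<in>UNIV. dz C (\<lambda>w. of_real (u w)) (\<Phi> ?x) * coord_deriv r \<theta> \<zeta> C y +
      dzbar C (\<lambda>w. of_real (u w)) (\<Phi> ?x) * cnj (coord_deriv r \<theta> \<zeta> C y))"
    unfolding F_def derivative_wirtinger[OF uc] by simp
  have fF: "frame r (\<eta> \<zeta>) A F =
      (\<Sum>C\<in>UNIV. dz C (\<lambda>w. of_real (u w)) (\<Phi> ?x) * frame_coeff \<sigma> \<rho> A C ?x)"
    unfolding F frame_sum[OF finite] frame_add frame_mult frame_cnj frame_coord[OF r] frame_bar_coord[OF r]
    by simp
  show "hopf_field h A U r \<theta> \<zeta> = (\<Sum>C\<in>UNIV. dz C (\<lambda>w. of_real (u w)) (\<Phi> ?x) * frame_coeff \<sigma> \<rho> A C ?x)"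
    unfolding fF[symmetric] by (rule hopf_field_eqI[OF dU wirtinger_h(1)[OF \<zeta>]])
  have "hopf_field_bar h A U r \<theta> \<zeta> = frame_bar r (\<eta> \<zeta>) A F"
    by (rule hopf_field_bar_eqI[OF dU wirtinger_h(2)[OF \<zeta>]])
  \<comment> \<open>As \<open>u\<close> is real, F equals its own conjugate, which turns the barred
    value into the conjugate of the unbarred one.\<close>
  also have "\<dots> = frame_bar r (\<eta> \<zeta>) A (\<lambda>y. cnj (F y))"
    unfolding F_def complex_cnj_complex_of_real ..
  finally show "hopf_field_bar h A U r \<theta> \<zeta> =
      (\<Sum>C\<in>UNIV. dzbar C (\<lambda>w. of_real (u w)) (\<Phi> ?x) * cnj (frame_coeff \<sigma> \<rho> A C ?x))"
    unfolding frame_bar_cnj fF by (simp add: cnj_dz_of_real[OF u'[OF \<Phi>]])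
qed

text \<open>Applying X_A to \<Sum>_C cnj (X_B z^C) \<partial>u/\<partial>(cnj z^C) produces the
  Hessian form when it hits the derivative of u. When it hits the coefficients it produces
  -\<lambda>_AB times the sum that represents the barred radial derivative of u, exactly what the
  added term cancels.\<close>

lemma second_hopf_fields:
  assumes x: "(r, \<theta>, \<zeta>) \<in> chart_domain"
  defines "Q \<equiv> \<lambda>A B. \<Sum>C\<in>UNIV. \<Sum>E\<in>UNIV. frame_coeff \<sigma> \<rho> A E (r, \<theta>, \<zeta>) *
     complex_hessian u (\<Phi> (r, \<theta>, \<zeta>)) $ E $ C * cnj (frame_coeff \<sigma> \<rho> B C (r, \<theta>, \<zeta>))"
  shows "hopf_field h A (hopf_field_bar h B U) r \<theta> \<zeta> +
      frame_torsion r \<zeta> A B * hopf_field_bar h None U r \<theta> \<zeta> = Q A B"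
    and "hopf_field_bar h B (hopf_field h A U) r \<theta> \<zeta> +
      frame_torsion r \<zeta> A B * hopf_field h None U r \<theta> \<zeta> = cnj (Q B A)"
proof -
  let ?x = "(r, \<theta>, \<zeta>)"
  have r: "0 < r" and \<zeta>: "\<zeta> \<in> W" and \<Phi>: "\<Phi> ?x \<in> D"
    using x by auto
  define g where "g C = dzbar C (\<lambda>w. complex_of_real (u w))" for C
  define G where "G B x = (\<Sum>C\<in>UNIV. cnj (frame_coeff \<sigma> \<rho> B C x) * g C (\<Phi> x))" for B x
  have bar_eq: "uncurry3 (hopf_field_bar h B U) x = G B x"
    and eq: "uncurry3 (hopf_field h B U) x = cnj (G B x)" if "x \<in> chart_domain" for B x
    using hopf_field_pullback[of "fst x" "fst (snd x)" "snd (snd x)" B] that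
      cnj_dz_of_real[OF u'[of "\<Phi> x"], symmetric]
    by (simp_all add: uncurry3_def G_def g_def mult.commute)
  have "\<exists>G'. (G B has_derivative G') (at ?x) \<and>
      (\<forall>A. frame r (\<eta> \<zeta>) A G' = Q A B - frame_torsion r \<zeta> A B * G None ?x)" for B
  proof -
    have "\<exists>M. (frame_coeff \<sigma> \<rho> B C has_derivative M) (at ?x) \<and> (\<forall>A. frame_bar r (\<eta> \<zeta>) A M =
        - cnj (frame_torsion r \<zeta> A B) * frame_coeff \<sigma> \<rho> None C ?x)" for C
      using frame_coeff_derivative[OF r \<zeta>, of B C \<theta>] by metis
    then obtain M where M: "\<And>C. (frame_coeff \<sigma> \<rho> B C has_derivative M C) (at ?x)"
      "\<And>A C. frame_bar r (\<eta> \<zeta>) A (M C) = - cnj (frame_torsion r \<zeta> A B) * frame_coeff \<sigma> \<rho> None C ?x"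
      by metis
    define g' where "g' C y = (complex_of_real (u'' (\<Phi> ?x) y (axis C 1)) +
        \<i> * of_real (u'' (\<Phi> ?x) y (axis C \<i>))) / 2" for C y
    have g': "(g C has_derivative g' C) (at (\<Phi> ?x))" for C
      unfolding g_def g'_def by (rule has_derivative_dzbar[OF D u' u'' cont \<Phi>])
    \<comment> \<open>The second summand is conjugate-linear in v; composed with the coordinates it
      is killed by the unbarred fields, so only Hessian entries survive.\<close>
    have g'_eq: "g' C v = (\<Sum>E\<in>UNIV. complex_hessian u (\<Phi> ?x) $ E $ C * v $ E + dzbar E (g C) (\<Phi> ?x) * cnj (v $ E))" for C v
      using derivative_wirtinger[OF g'] by (simp add: complex_hessian_def g_def)
    define G' where "G' y = (\<Sum>C\<in>UNIV. cnj (frame_coeff \<sigma> \<rho> B C ?x) * g' C (\<chi> E. coord_deriv r \<theta> \<zeta> E y) +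
        g C (\<Phi> ?x) * cnj (M C y))" for y
    have "(G B has_derivative G') (at ?x)"
    proof -
      have "((\<lambda>x. cnj (frame_coeff \<sigma> \<rho> B C x) * g C (\<Phi> x)) has_derivative
          (\<lambda>y. cnj (frame_coeff \<sigma> \<rho> B C ?x) * g' C (\<chi> E. coord_deriv r \<theta> \<zeta> E y) +
        cnj (M C y) * g C (\<Phi> ?x))) (at ?x)" for C
      proof (rule has_derivative_mult)
        show "((\<lambda>x. cnj (frame_coeff \<sigma> \<rho> B C x)) has_derivative (\<lambda>y. cnj (M C y))) (at ?x)"
          by (rule bounded_linear.has_derivative[OF bounded_linear_cnj M(1)])
        show "((\<lambda>x. g C (\<Phi> x)) has_derivative (\<lambda>y. g' C (\<chi> E. coord_deriv r \<theta> \<zeta> E y))) (at ?x)"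
          using has_derivative_compose[OF has_derivative_hopf_map[OF r \<zeta>] g']
          by simp
      qed
      then show ?thesis
        unfolding G_def G'_def mult.commute[of "g _ _"] by (rule has_derivative_sum)
    qed
    moreover have "frame r (\<eta> \<zeta>) A G' = Q A B - frame_torsion r \<zeta> A B * G None ?x" for A
    proof -
      have "frame r (\<eta> \<zeta>) A G' = (\<Sum>C\<in>UNIV. cnj (frame_coeff \<sigma> \<rho> B C ?x) *
          (\<Sum>E\<in>UNIV. complex_hessian u (\<Phi> ?x) $ E $ C * frame_coeff \<sigma> \<rho> A E ?x) +
          g C (\<Phi> ?x) * cnj (- cnj (frame_torsion r \<zeta> A B) * frame_coeff \<sigma> \<rho> None C ?x))"
        unfolding G'_def g'_eq vec_lambda_beta frame_sum[OF finite] frame_add frame_mult frame_cnj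
          frame_coord[OF r] frame_bar_coord[OF r] M(2) by simp
      also have "\<dots> = Q A B - frame_torsion r \<zeta> A B * G None ?x"
        unfolding sum.distrib Q_def G_def
        by (simp add: sum_distrib_left sum_negf mult_ac)
      finally show ?thesis .
    qed
    ultimately show ?thesis
      by blast
  qed
  then obtain G' where G': "\<And>B. (G B has_derivative G' B) (at ?x)"
    "\<And>A B. frame r (\<eta> \<zeta>) A (G' B) = Q A B - frame_torsion r \<zeta> A B * G None ?x"
    by metis
  have None: "hopf_field_bar h None U r \<theta> \<zeta> = G None ?x" "hopf_field h None U r \<theta> \<zeta> = cnj (G None ?x)"
    using bar_eq[OF x] eq[OF x] by (simp_all add: uncurry3_def)
  have "(uncurry3 (hopf_field_bar h B U) has_derivative G' B) (at ?x)"
    by (rule has_derivative_transform_within_open[OF G'(1) open_chart_domain x]) (rule bar_eq[symmetric])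
  from hopf_field_eqI[OF this wirtinger_h(1)[OF \<zeta>]]
  show "hopf_field h A (hopf_field_bar h B U) r \<theta> \<zeta> +
      frame_torsion r \<zeta> A B * hopf_field_bar h None U r \<theta> \<zeta> = Q A B"
    unfolding None by (simp add: G'(2))
  \<comment> \<open>The opposite order of the fields is obtained by conjugating the previous
    computation with A and B exchanged; the Hermitian symmetry of \<lambda> restores its
    indices.\<close>
  have "((\<lambda>x. cnj (G A x)) has_derivative (\<lambda>y. cnj (G' A y))) (at ?x)"
    by (rule bounded_linear.has_derivative[OF bounded_linear_cnj G'(1)])
  then have "(uncurry3 (hopf_field h A U) has_derivative (\<lambda>y. cnj (G' A y))) (at ?x)"
    by (rule has_derivative_transform_within_open[OF _ open_chart_domain x]) (rule eq[symmetric])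
  from hopf_field_bar_eqI[OF this wirtinger_h(2)[OF \<zeta>]]
  show "hopf_field_bar h B (hopf_field h A U) r \<theta> \<zeta> +
      frame_torsion r \<zeta> A B * hopf_field h None U r \<theta> \<zeta> = cnj (Q B A)"
    unfolding None frame_bar_cnj by (simp add: G'(2) cnj_frame_torsion)
qed

end

end

text \<open>The claim concerns one point and an arbitrary chart at it, so it applies to any choice
  of charts over D. Both matrices are identified with the Hessian transported to the frame.\<close>

lemma S_matrices_congruent_hessian:
  fixes u :: "complex^('n::finite option) \<Rightarrow> real"
  assumes D: "open D" "C2_on D u" and p: "p \<in> D" "hopf_at p c"
  shows "S_star_matrix c u = S_matrix c u"
    and "pos_semidef (S_matrix c u) \<longleftrightarrow> pos_semidef (complex_hessian u p)"
    and "pos_def (S_matrix c u) \<longleftrightarrow> pos_def (complex_hessian u p)"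
proof -
  obtain W where W: "proj c \<in> W" "hopf_gauge W (phase c) (basic c)" and c: "bij (perm c)" "0 < rad c"
    "hopf_map (perm c) (phase c) (rad c) (ang c) (proj c) = p"
    using p(2) unfolding hopf_at_def by blast
  obtain \<gamma> where "gauge_connection W (phase c) (basic c) \<gamma>"
    using hopf_gauge_connection[OF W(2)] by blast
  then interpret hopf_chart W "phase c" "basic c" \<gamma> "perm c"
    using c(1) by unfold_locales
  obtain u' u'' where u: "\<And>x. x \<in> D \<Longrightarrow> (u has_derivative blinfun_apply (u' x)) (at x)"
    "\<And>x. x \<in> D \<Longrightarrow> (u' has_derivative blinfun_apply (u'' x)) (at x)" "continuous_on D u''"
    using C2_onE[OF D(2)] by blast
  let ?x = "(rad c, ang c, proj c)"
  have \<Phi>: "uncurry3 (hopf_map (perm c) (phase c)) ?x = p"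
    using c(3) by (simp add: uncurry3_def)
  have x: "?x \<in> {x. 0 < fst x \<and> snd (snd x) \<in> W \<and> uncurry3 (hopf_map (perm c) (phase c)) x \<in> D}"
    using c W(1) p(1) \<Phi> by simp
  define M where "M A C = frame_coeff (perm c) (phase c) A C ?x" for A C
  define Q where "Q A B = (\<Sum>C\<in>UNIV. \<Sum>E\<in>UNIV. M A E * complex_hessian u p $ E $ C * cnj (M B C))" for A B
  have U: "pullback c u = (\<lambda>r \<theta> \<zeta>. of_real (u (hopf_map (perm c) (phase c) r \<theta> \<zeta>)))"
    by (simp add: fun_eq_iff pullback_def)
  have fields: "hopf_field (basic c) A (hopf_field_bar (basic c) B (pullback c u)) (rad c) (ang c) (proj c) +
      frame_torsion (rad c) (proj c) A B * hopf_field_bar (basic c) None (pullback c u) (rad c) (ang c) (proj c) = Q A B"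
    "hopf_field_bar (basic c) B (hopf_field (basic c) A (pullback c u)) (rad c) (ang c) (proj c) +
      frame_torsion (rad c) (proj c) A B * hopf_field (basic c) None (pullback c u) (rad c) (ang c) (proj c) = cnj (Q B A)"
    for A B
    unfolding U Q_def M_def \<Phi>[symmetric] by (rule second_hopf_fields[OF D(1) u x]; assumption)+
  have SQ: "S_matrix c u $ A $ B = Q A B" for A B
    unfolding fields(1)[of A B, symmetric]
    by (auto simp: S_matrix_def Let_def hopf_field_def hopf_field_bar_def frame_torsion_def
        mixed_derivative_h[OF W(1)] mult_ac split: option.split)
  have SQ': "S_star_matrix c u $ A $ B = cnj (Q B A)" for A B
    unfolding fields(2)[where A = A and B = B, symmetric]
    by (auto simp: S_star_matrix_def Let_def hopf_field_def hopf_field_bar_def frame_torsion_def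
        mixed_derivative_h[OF W(1)] mult_ac split: option.split)
  have inj: "v = 0" if "\<And>C. (\<Sum>A\<in>UNIV. v $ A * M A C) = 0" for v :: "complex^('n option)"
    using frame_coeff_inj[OF c(2) W(1)] that unfolding M_def by blast
  have herm: "hermitian (complex_hessian u p)"
    by (rule hermitian_complex_hessian[OF D(1) u p(1)])
  have "hermitian (S_matrix c u)"
    by (rule pos_congruence(1)[OF herm SQ[unfolded Q_def] inj])
  \<comment> \<open>The entries of the second matrix are conjugates of transposed entries of the
    first, so Hermitian symmetry makes the two equal.\<close>
  then show "S_star_matrix c u = S_matrix c u"
    unfolding vec_eq_iff hermitian_def SQ SQ' by metis
  show "pos_semidef (S_matrix c u) \<longleftrightarrow> pos_semidef (complex_hessian u p)"
    by (rule pos_congruence(2)[OF herm SQ[unfolded Q_def] inj])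
  show "pos_def (S_matrix c u) \<longleftrightarrow> pos_def (complex_hessian u p)"
    by (rule pos_congruence(3)[OF herm SQ[unfolded Q_def] inj])
qed

theorem proposition5p2:
  fixes D :: "(complex^('n::finite option)) set"
    and u :: "complex^('n option) \<Rightarrow> real"
    and c :: "complex^('n option) \<Rightarrow> 'n hopf"
  assumes "open D" and "connected D" and "0 \<notin> D"
    and "C2_on D u"
    and "\<And>p. p \<in> D \<Longrightarrow> hopf_at p (c p)"
  shows "(plurisubharmonic_on D u \<longleftrightarrow> (\<forall>p\<in>D. pos_semidef (S_matrix (c p) u))) \<and>
         (plurisubharmonic_on D u \<longleftrightarrow> (\<forall>p\<in>D. pos_semidef (S_star_matrix (c p) u))) \<and>
         (strictly_plurisubharmonic_on D u \<longleftrightarrow> (\<forall>p\<in>D. pos_def (S_matrix (c p) u))) \<and>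
         (strictly_plurisubharmonic_on D u \<longleftrightarrow> (\<forall>p\<in>D. pos_def (S_star_matrix (c p) u)))"
  \<comment> \<open>All four equivalences become pointwise statements about the complex Hessian, to
    be compared in the chart chosen at each point.\<close>
  unfolding plurisubharmonic_on_iff_hessian[OF assms(1,4)] strictly_plurisubharmonic_on_def
  using S_matrices_congruent_hessian[OF assms(1,4) _ assms(5)] by simp

end
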